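(* Fix $d\ge2$. For $n\ge1$ let $\mathcal{B}^d_n\subset\mathbb{R}^d$ be the open ball of volume $n$ centered at the origin. The projective limit of any projective system of random graphs on $\mathcal{B}^d_n$ that are invariant under rotations is a random graph on $\mathbb{R}^d$ that is invariant under rotations.
   Context: For $\mathbb{L}=\mathcal{B}^d_n$ or $\mathbb{L}=\mathbb{R}^d$, $M_s(\mathbb{L}\times\mathbb{L})$ is the set of symmetric (invariant under $(x,y)\mapsto(y,x)$) locally finite simple counting measures on $\mathbb{L}\times\mathbb{L}$ (every point has a neighbourhood of finite measure; atoms have mass $1$), with the $\sigma$-algebra generated by the maps $\xi\mapsto\xi(A)$, $A$ Borel. A random graph on $\mathbb{L}$ is a probability measure on $M_s(\mathbb{L}\times\mathbb{L})$ (atoms represent edges). A projective system of random graphs on $\mathcal{B}^d_n$ is a sequence $(\mu_n)_{n\ge1}$ of random graphs on $\mathcal{B}^d_n$ with $\mu_n=\pi_{mn}*\mu_m$ (push-forward) for all $n\le m$, where $\pi_{mn}$ restricts a measure on $\mathcal{B}^d_m\times\mathcal{B}^d_m$ to $\mathcal{B}^d_n\times\mathcal{B}^d_n$. Its projective limit is the unique random graph $\mu_{\mathbb{N}}$ on $\mathbb{R}^d$ with $\pi_n*\mu_{\mathbb{N}}=\mu_n$ for all $n$, where $\pi_n$ is restriction to $\mathcal{B}^d_n\times\mathcal{B}^d_n$; the assertion includes its existence. A rotation $\varphi$ of $\mathbb{R}^d$ about the origin acts on $\mathbb{R}^d$ and, by restriction, on each ball, and acts on measures by $\varphi\xi(A)=\xi((\varphi^{-1}\otimes\varphi^{-1})(A))$,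 where $(f\otimes f)(x,y)=(f(x),f(y))$. A random graph $\mu$ is invariant under rotations if $\mu(A)=\mu(\varphi^{-1}A)$ for every rotation $\varphi$ about the origin and every measurable $A\subseteq M_s(\mathbb{L}\times\mathbb{L})$. *)

theory Defs
  imports "HOL-Probability.Probability"
begin

text \<open>
  A measure on the subspace \<open>L \<times> L\<close> is a measure whose space is \<open>L \<times> L\<close> and whose
  measurable sets are the Borel sets of the subspace topology. Being a counting measure means
  taking values in the natural numbers together with infinity.  Local finiteness refers to the
  points of \<open>L \<times> L\<close> only: for a ball \<open>L\<close>, infinitely many atoms may accumulate at the boundary.
\<close>
definition sym_counting_measures ::
    "'a::euclidean_space set \<Rightarrow> ('a \<times> 'a) measure set" where
  "sym_counting_measures L = {\<xi>.
     sets \<xi> = sets (restrict_space borel (L \<times> L)) \<and>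
     (\<forall>A\<in>sets \<xi>. emeasure \<xi> A \<in> range ennreal_of_enat) \<and>
     (\<forall>x\<in>L \<times> L. \<exists>U. open U \<and> x \<in> U \<and> emeasure \<xi> (U \<inter> (L \<times> L)) < \<infinity>) \<and>
     (\<forall>x\<in>L \<times> L. emeasure \<xi> {x} \<noteq> 0 \<longrightarrow> emeasure \<xi> {x} = 1) \<and>
     distr \<xi> \<xi> prod.swap = \<xi>}"

definition sym_counting_space ::
    "'a::euclidean_space set \<Rightarrow> ('a \<times> 'a) measure measure" where
  "sym_counting_space L = sigma (sym_counting_measures L)
     {(\<lambda>\<xi>. emeasure \<xi> A) -` B \<inter> sym_counting_measures L | A B.
       A \<in> sets (restrict_space borel (L \<times> L)) \<and> B \<in> sets borel}"

definition random_graph ::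
    "'a::euclidean_space set \<Rightarrow> ('a \<times> 'a) measure measure \<Rightarrow> bool" where
  "random_graph L \<mu> \<longleftrightarrow> prob_space \<mu> \<and> sets \<mu> = sets (sym_counting_space L)"

definition restrict_graph :: "'a set \<Rightarrow> ('a \<times> 'a) measure \<Rightarrow> ('a \<times> 'a) measure" where
  "restrict_graph L \<xi> = restrict_space \<xi> (L \<times> L)"

definition vol_ball :: "nat \<Rightarrow> 'a::euclidean_space set" where
  "vol_ball n = (THE B. \<exists>r. B = ball 0 r \<and> emeasure lborel B = of_nat n)"

definition projective_system ::
    "(nat \<Rightarrow> ('a::euclidean_space \<times> 'a) measure measure) \<Rightarrow> bool" where
  "projective_system \<mu> \<longleftrightarrow>
     (\<forall>n\<ge>1. random_graph (vol_ball n) (\<mu> n)) \<and>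
     (\<forall>n m. 1 \<le> n \<and> n \<le> m \<longrightarrow>
        \<mu> n = distr (\<mu> m) (sym_counting_space (vol_ball n)) (restrict_graph (vol_ball n)))"

definition is_projective_limit ::
    "(nat \<Rightarrow> ('a::euclidean_space \<times> 'a) measure measure) \<Rightarrow> ('a \<times> 'a) measure measure \<Rightarrow> bool"
  where
  "is_projective_limit \<mu> \<nu> \<longleftrightarrow>
     random_graph UNIV \<nu> \<and>
     (\<forall>n\<ge>1. distr \<nu> (sym_counting_space (vol_ball n)) (restrict_graph (vol_ball n)) = \<mu> n)"

definition is_rotation :: "(real^'n \<Rightarrow> real^'n) \<Rightarrow> bool" where
  "is_rotation \<phi> \<longleftrightarrow> (\<exists>Q. rotation_matrix Q \<and> \<phi> = (\<lambda>x. Q *v x))"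

text \<open>
  The image of a set under \<open>\<phi>\<inverse> \<otimes> \<phi>\<inverse>\<close> is its preimage under \<open>\<phi> \<otimes> \<phi>\<close>, so the rotated measure is
  the push-forward along \<open>\<phi> \<otimes> \<phi>\<close>; when \<open>\<phi>\<close> maps \<open>L\<close> onto itself, it is again a measure on
  \<open>L \<times> L\<close>.
\<close>
definition act :: "('a \<Rightarrow> 'a) \<Rightarrow> ('a \<times> 'a) measure \<Rightarrow> ('a \<times> 'a) measure" where
  "act \<phi> \<xi> = distr \<xi> \<xi> (map_prod \<phi> \<phi>)"

definition rotation_invariant :: "((real^'n) \<times> (real^'n)) measure measure \<Rightarrow> bool" where
  "rotation_invariant \<mu> \<longleftrightarrow>
     (\<forall>\<phi>. is_rotation \<phi> \<longrightarrow>
        (\<forall>A\<in>sets \<mu>. emeasure \<mu> A = emeasure \<mu> (act \<phi> -` A \<inter> space \<mu>)))"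

text \<open>The ball of prescribed volume is well defined.\<close>

lemma emeasure_ball_nat_ex1:
  "\<exists>!B::'a::euclidean_space set. \<exists>r. B = ball 0 r \<and> emeasure lborel B = of_nat n"
proof (rule ex_ex1I)
  define c where "c = unit_ball_vol (real DIM('a))"
  have c: "c > 0" unfolding c_def by simp
  define r where "r = root DIM('a) (real n / c)"
  have r0: "r \<ge> 0" using c by (simp add: r_def)
  have "r ^ DIM('a) = real n / c" using c by (simp add: r_def)
  then have "emeasure lborel (ball (0::'a) r) = ennreal (real n)"
    using c r0 by (simp add: emeasure_ball flip: c_def)
  then show "\<exists>B::'a set. \<exists>r. B = ball 0 r \<and> emeasure lborel B = of_nat n"
    by (auto simp: ennreal_of_nat_eq_real_of_nat)
next
  fix B C :: "'a set"
  assume B: "\<exists>r. B = ball 0 r \<and> emeasure lborel B = of_nat n"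
    and C: "\<exists>r. C = ball 0 r \<and> emeasure lborel C = of_nat n"
  have normalise: "\<exists>r\<ge>0. D = ball 0 r \<and> real n = unit_ball_vol (real DIM('a)) * r ^ DIM('a)"
    if "\<exists>r. D = ball 0 r \<and> emeasure lborel D = of_nat n" for D :: "'a set"
  proof -
    from that obtain r where r: "D = ball 0 r" "emeasure lborel D = of_nat n" by blast
    have D: "D = ball 0 (max r 0)" using r(1) by (cases "r \<ge> 0") (auto simp: max_def)
    have "ennreal (real n) = ennreal (unit_ball_vol (real DIM('a)) * max r 0 ^ DIM('a))"
      using r(2) unfolding D by (simp add: emeasure_ball ennreal_of_nat_eq_real_of_nat)
    then have "real n = unit_ball_vol (real DIM('a)) * max r 0 ^ DIM('a)"
      by (subst (asm) ennreal_inj) auto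
    with D show ?thesis by (intro exI[of _ "max r 0"]) auto
  qed
  obtain r s where "r \<ge> 0" "s \<ge> 0" "B = ball 0 r" "C = ball 0 s"
    "unit_ball_vol (real DIM('a)) * r ^ DIM('a) = unit_ball_vol (real DIM('a)) * s ^ DIM('a)"
    using normalise[OF B] normalise[OF C] by auto
  moreover from this have "r ^ DIM('a) = s ^ DIM('a)"
    using unit_ball_vol_pos[of "real DIM('a)"] by (auto simp del: unit_ball_vol_pos)
  ultimately show "B = C" by (metis DIM_positive power_eq_imp_eq_base)
qed

lemma vol_ball_spec:
  obtains r where "(vol_ball n :: 'a::euclidean_space set) = ball 0 r"
    and "emeasure lborel (vol_ball n :: 'a set) = of_nat n"
  using theI'[OF emeasure_ball_nat_ex1[where 'a='a and n=n]] unfolding vol_ball_def by blast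

end

theory Submission
  imports Defs
begin

text \<open>
  A locally finite simple counting measure on \<open>L \<times> L\<close> is the counting measure of its set of atoms, and
  every atom \<open>x\<close> is isolated by some member \<open>U\<^sub>j\<close> of a countable basis, in the sense that \<open>x\<close> is the
  only atom in \<open>U\<^sub>j\<close>. Recording for every \<open>j\<close> whether \<open>U\<^sub>j\<close> contains exactly one atom, and which, embeds
  the space of graphs measurably into a Polish space of sequences, with a measurable left inverse.
  The Daniell-Kolmogorov theorem applies to the codes of the restrictions to the balls; almost
  every sequence of codes decodes to a consistent sequence of graphs, which can be glued.
  A graph is determined by its restrictions to the balls, so the limit is unique. Restriction to a
  ball commutes with rotations, so a rotated limit is a limit of the same system, hence equal to
  the original one.
\<close>

section \<open>Counting measures and their sets of atoms\<close>

text \<open>The Daniell-Kolmogorov theorem needs Polish coordinate spaces with their Borel sets,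
  whereas \<open>sym_counting_space\<close> carries only the sigma-algebra generated by evaluations.
  Rather than equipping it with a topology, the proof moves to sequences of codes and uses nothing
  of the coding but that it is measurable and has a measurable left inverse; the left inverse must
  be defined on all sequences, which forces the set of decodable sequences to be Borel. That atoms
  are isolated rests on integrality: near a point the masses of shrinking neighbourhoods are finite
  integers, so their limit is attained. The code of a restricted graph is not a part of the code of
  the larger graph, because a basis set with two atoms may keep only one of them after restriction.
  Coherence of codes is therefore expressed by decoding, restricting and encoding again. It is a
  countable family of equations, each involving two coordinates only, so it can be checked almost
  surely on the two-dimensional marginals.\<close>

text \<open>The push-forward along the inclusion cuts the power set of \<open>T\<close> down to the
  Borel sets of \<open>L \<times> L\<close>, the sigma-algebra that
  \<open>sym_counting_measures\<close> prescribes.\<close>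

definition config :: "'a::euclidean_space set \<Rightarrow> ('a \<times> 'a) set \<Rightarrow> ('a \<times> 'a) measure" where
  "config L T = distr (count_space T) (restrict_space borel (L \<times> L)) (\<lambda>x. x)"

text \<open>These are exactly the sets of atoms of members of \<open>sym_counting_measures L\<close>
  when \<open>L\<close> is open. Finiteness is asked near points of \<open>L \<times> L\<close>
  only, so accumulation at the boundary is allowed.\<close>

definition edge_set :: "'a::euclidean_space set \<Rightarrow> ('a \<times> 'a) set \<Rightarrow> bool" where
  "edge_set L T \<longleftrightarrow> T \<subseteq> L \<times> L \<and> prod.swap ` T = T \<and>
     (\<forall>x\<in>L \<times> L. \<exists>U. open U \<and> x \<in> U \<and> finite (U \<inter> T))"

definition atoms :: "'b measure \<Rightarrow> 'b set" where
  "atoms \<xi> = {x \<in> space \<xi>. emeasure \<xi> {x} \<noteq> 0}"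

lemma sets_config [simp, measurable_cong]: "sets (config L T) = sets (restrict_space borel (L \<times> L))"
  by (simp add: config_def)

lemma space_config [simp]: "space (config L T) = L \<times> L"
  by (simp add: config_def space_restrict_space)

lemma sets_restrict_borel_subset:
  "A \<in> sets (restrict_space borel S) \<Longrightarrow> A \<subseteq> S"
  by (drule sets.sets_into_space) (simp add: space_restrict_space)

lemma emeasure_config:
  assumes "T \<subseteq> L \<times> L" "A \<in> sets (restrict_space borel (L \<times> L))"
  shows "emeasure (config L T) A = emeasure (count_space UNIV) (A \<inter> T)"
proof -
  have "(\<lambda>x. x) \<in> measurable (count_space T) (restrict_space borel (L \<times> L))"
    using assms(1) by (auto simp: space_restrict_space)
  then show ?thesis
    using assms unfolding config_def
    by (subst emeasure_distr) (auto simp: emeasure_count_space)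
qed

lemma Int_in_restrict_borel:
  "A \<in> sets borel \<Longrightarrow> A \<inter> S \<in> sets (restrict_space borel S)"
  by (auto simp: sets_restrict_space Int_commute)

lemma singleton_in_restrict_borel:
  "x \<in> S \<Longrightarrow> {x :: 'b::t1_space} \<in> sets (restrict_space borel S)"
  by (auto simp: sets_restrict_space intro!: image_eqI[of _ _ "{x}"])

lemma emeasure_config_singleton:
  assumes "T \<subseteq> L \<times> L" "x \<in> L \<times> L"
  shows "emeasure (config L T) {x} = (if x \<in> T then 1 else 0)"
  using assms by (auto simp: emeasure_config singleton_in_restrict_borel)

lemma atoms_config: "T \<subseteq> L \<times> L \<Longrightarrow> atoms (config L T) = T"
  by (auto simp: atoms_def emeasure_config_singleton subset_iff split: if_splits)

lemma count_space_UNIV_bij: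
  assumes "inj_on f A" shows "emeasure (count_space UNIV) (f ` A) = emeasure (count_space UNIV) A"
  using assms by (auto simp: emeasure_count_space card_image finite_image_iff)

text \<open>Injectivity keeps distinct atoms distinct, so no multiplicities arise. It serves both
  the swap of coordinates and the rotations.\<close>

lemma distr_config:
  assumes T: "T \<subseteq> L \<times> L" and f: "f \<in> borel_measurable borel" "inj f" "f ` (L \<times> L) \<subseteq> L \<times> L"
  shows "distr (config L T) (config L T) f = config L (f ` T)"
proof (rule measure_eqI)
  fix A assume "A \<in> sets (distr (config L T) (config L T) f)"
  then have A: "A \<in> sets (restrict_space borel (L \<times> L))" by simp
  have f': "f \<in> measurable (restrict_space borel (L \<times> L)) (restrict_space borel (L \<times> L))"
    using f by (intro measurable_restrict_space3) auto
  have m: "f \<in> measurable (config L T) (config L T)"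
    using f' by (simp cong: measurable_cong_sets)
  have pre: "f -` A \<inter> (L \<times> L) \<in> sets (restrict_space borel (L \<times> L))"
    using measurable_sets[OF f' A] by (simp add: space_restrict_space)
  have "emeasure (distr (config L T) (config L T) f) A = emeasure (config L T) (f -` A \<inter> (L \<times> L))"
    using m A by (subst emeasure_distr) auto
  also have "\<dots> = emeasure (count_space UNIV) (f -` A \<inter> T)"
    using T pre by (subst emeasure_config) (auto intro!: arg_cong[where f="emeasure _"])
  also have "\<dots> = emeasure (count_space UNIV) (f ` (f -` A \<inter> T))"
    using f(2) by (subst count_space_UNIV_bij) (auto intro: inj_on_subset)
  also have "f ` (f -` A \<inter> T) = A \<inter> f ` T" by auto
  also have "emeasure (count_space UNIV) \<dots> = emeasure (config L (f ` T)) A"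
    using T f A by (subst emeasure_config) auto
  finally show "emeasure (distr (config L T) (config L T) f) A = emeasure (config L (f ` T)) A" .
qed simp

lemma prod_swap_image_subset: "T \<subseteq> L \<times> L \<Longrightarrow> prod.swap ` T \<subseteq> L \<times> L"
  by auto

lemma distr_config_swap:
  "T \<subseteq> L \<times> L \<Longrightarrow> distr (config L T) (config L T) prod.swap = config L (prod.swap ` T)"
  by (intro distr_config borel_measurable_continuous_onI continuous_on_swap) auto

text \<open>As \<open>L\<close> is open, Borel sets of the subspace \<open>L \<times> L\<close> are
  Borel in the whole space and hence in \<open>K \<times> K\<close>; both sides then count the same
  points.\<close>

lemma restrict_graph_config:
  assumes "open L" "L \<subseteq> K" "T \<subseteq> K \<times> K"
  shows "restrict_graph L (config K T) = config L (T \<inter> L \<times> L)"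
proof (rule measure_eqI)
  have L: "L \<times> L \<in> sets borel" using assms(1) by (simp add: open_Times)
  have "L \<times> L = L \<times> L \<inter> (K \<times> K)" using assms(2) by auto
  with L have LK: "L \<times> L \<in> sets (restrict_space borel (K \<times> K))" by (auto simp: sets_restrict_space)
  have eq: "(K \<times> K) \<inter> (L \<times> L) = L \<times> L" using assms(2) by auto
  have sets: "sets (restrict_graph L (config K T)) = sets (restrict_space borel (L \<times> L))"
    unfolding restrict_graph_def
    by (subst sets_restrict_space_cong[OF sets_config])
      (simp add: sets_restrict_restrict_space eq)
  then show "sets (restrict_graph L (config K T)) = sets (config L (T \<inter> L \<times> L))" by simp
  fix A assume "A \<in> sets (restrict_graph L (config K T))"
  then have A: "A \<in> sets (restrict_space borel (L \<times> L))" by (simp only: sets)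
  have AL: "A \<subseteq> L \<times> L" using A by (rule sets_restrict_borel_subset)
  have "A \<in> sets borel" using A L by (subst (asm) sets_restrict_space_iff) auto
  moreover have "A = K \<times> K \<inter> A" using AL assms(2) by auto
  ultimately have AK: "A \<in> sets (restrict_space borel (K \<times> K))" by (auto simp: sets_restrict_space)
  have "emeasure (restrict_graph L (config K T)) A = emeasure (config K T) A"
    unfolding restrict_graph_def using AL LK
    by (subst emeasure_restrict_space) (simp_all add: eq Int_commute)
  also have "\<dots> = emeasure (count_space UNIV) (A \<inter> (T \<inter> L \<times> L))"
    using AK assms(3) AL by (subst emeasure_config) (auto intro!: arg_cong[where f="emeasure _"])
  also have "\<dots> = emeasure (config L (T \<inter> L \<times> L)) A"
    using A by (subst emeasure_config) auto
  finally show "emeasure (restrict_graph L (config K T)) A = emeasure (config L (T \<inter> L \<times> L)) A" .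
qed

lemma config_in_sym_counting_measures:
  assumes "open L" "edge_set L T"
  shows "config L T \<in> sym_counting_measures L"
proof -
  have T: "T \<subseteq> L \<times> L" "prod.swap ` T = T"
    and fin: "\<And>x. x \<in> L \<times> L \<Longrightarrow> \<exists>U. open U \<and> x \<in> U \<and> finite (U \<inter> T)"
    using assms(2) by (auto simp: edge_set_def)
  have "emeasure (config L T) A \<in> range ennreal_of_enat" if "A \<in> sets (config L T)" for A
  proof -
    have "emeasure (config L T) A = emeasure (count_space UNIV) (A \<inter> T)"
      using that T by (simp add: emeasure_config)
    also have "\<dots> \<in> range ennreal_of_enat"
    proof (cases "finite (A \<inter> T)")
      case True
      then have "emeasure (count_space UNIV) (A \<inter> T) = ennreal_of_enat (enat (card (A \<inter> T)))"
        by (simp add: emeasure_count_space)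
      then show ?thesis by blast
    next
      case False
      then have "emeasure (count_space UNIV) (A \<inter> T) = ennreal_of_enat \<infinity>"
        by (simp add: emeasure_count_space)
      then show ?thesis by blast
    qed
    finally show ?thesis .
  qed
  moreover have "\<exists>U. open U \<and> x \<in> U \<and> emeasure (config L T) (U \<inter> L \<times> L) < \<infinity>" if x: "x \<in> L \<times> L" for x
  proof -
    obtain U where U: "open U" "x \<in> U" "finite (U \<inter> T)" using fin[OF x] by blast
    have "U \<inter> L \<times> L \<in> sets (restrict_space borel (L \<times> L))"
      using U(1) by (intro Int_in_restrict_borel) auto
    then have "emeasure (config L T) (U \<inter> L \<times> L) = emeasure (count_space UNIV) (U \<inter> L \<times> L \<inter> T)"
      using T by (intro emeasure_config)
    also have "U \<inter> L \<times> L \<inter> T = U \<inter> T" using T by auto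
    also have "emeasure (count_space UNIV) (U \<inter> T) < \<infinity>" 
      using U(3) by (simp add: emeasure_count_space of_nat_less_top)
    finally show ?thesis using U by blast
  qed
  moreover have "distr (config L T) (config L T) prod.swap = config L T"
    using T by (simp add: distr_config_swap)
  ultimately show ?thesis
    using T(1) by (auto simp: sym_counting_measures_def emeasure_config_singleton)
qed


section \<open>Isolation of atoms\<close>

text \<open>Finite values are integers, so a sequence that stays above its finite limit
  \<open>m\<close> and eventually falls below \<open>m + 1\<close> must equal \<open>m\<close>
  there.\<close>

lemma enat_valued_limit_attained:
  fixes X :: "nat \<Rightarrow> ennreal"
  assumes "X \<longlonglongrightarrow> l" "\<And>k. l \<le> X k" "\<And>k. X k \<in> range ennreal_of_enat"
    and l: "l \<in> range ennreal_of_enat" "l < \<infinity>"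
  shows "\<exists>k. X k = l"
proof -
  from l(1) obtain e where "l = ennreal_of_enat e" by blast
  with l(2) obtain m where m: "l = of_nat m" by (cases e) simp_all
  have "l < of_nat (Suc m)" unfolding m by (rule of_nat_less_iff[THEN iffD2]) simp
  with assms(1) have "eventually (\<lambda>k. X k < of_nat (Suc m)) sequentially"
    by (rule order_tendstoD)
  then obtain k where k: "X k < of_nat (Suc m)" by (auto simp: eventually_sequentially)
  obtain e where e: "X k = ennreal_of_enat e" using assms(3)[of k] by auto
  have "X k = of_nat m"
  proof (cases e)
    case (enat j)
    then have Xk: "X k = of_nat j" using e by simp
    have "j < Suc m" using k unfolding Xk by (simp only: of_nat_less_iff)
    moreover have "m \<le> j" using assms(2)[of k] unfolding Xk m by (simp only: of_nat_le_iff)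
    ultimately show ?thesis using Xk by simp
  next
    case infinity
    with e k show ?thesis by (simp add: less_top[symmetric])
  qed
  then show ?thesis using m by blast
qed

text \<open>Balls shrinking to \<open>x\<close> have masses tending to that of \<open>{x}\<close> by
  continuity from above, and integrality makes one of them attain the limit.\<close>

lemma open_nbhd_emeasure_singleton:
  fixes \<xi> :: "'b::metric_space measure"
  assumes sets: "sets \<xi> = sets (restrict_space borel W)"
    and enat: "\<And>A. A \<in> sets \<xi> \<Longrightarrow> emeasure \<xi> A \<in> range ennreal_of_enat"
    and x: "x \<in> W" and U: "open U" "x \<in> U" "emeasure \<xi> (U \<inter> W) < \<infinity>"
  shows "\<exists>V. open V \<and> x \<in> V \<and> emeasure \<xi> (V \<inter> W) = emeasure \<xi> {x}"
proof -
  \<comment> \<open>Intersecting with \<open>U\<close> keeps the masses finite, as continuity from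
    above requires.\<close>
  define V where "V k = ball x (1 / real (Suc k)) \<inter> U" for k
  have V: "open (V k)" "x \<in> V k" for k
    using U by (auto simp: V_def)
  have VS: "V k \<inter> W \<in> sets \<xi>" for k
    unfolding sets using V(1) by (intro Int_in_restrict_borel) auto
  have xS: "{x} \<in> sets \<xi>" unfolding sets using x by (rule singleton_in_restrict_borel)
  have US: "U \<inter> W \<in> sets \<xi>"
    unfolding sets using U(1) by (intro Int_in_restrict_borel) auto
  have fin: "emeasure \<xi> (V k \<inter> W) < \<infinity>" for k
    by (rule le_less_trans[OF emeasure_mono[OF _ US] U(3)]) (auto simp: V_def)
  have "(\<Inter>k. V k \<inter> W) = {x}"
  proof (intro equalityI subsetI)
    fix y assume y: "y \<in> (\<Inter>k. V k \<inter> W)"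
    show "y \<in> {x}"
    proof (rule ccontr)
      assume "y \<notin> {x}"
      then have "dist x y > 0" by simp
      then obtain k where "1 / real (Suc k) < dist x y" by (rule nat_approx_posE)
      moreover have "y \<in> V k" using y by blast
      then have "dist x y < 1 / real (Suc k)" by (simp add: V_def)
      ultimately show False by linarith
    qed
  next
    fix y assume "y \<in> {x}"
    then show "y \<in> (\<Inter>k. V k \<inter> W)" using V(2) x by blast
  qed
  moreover have "decseq (\<lambda>k. V k \<inter> W)"
  proof (rule decseq_SucI)
    fix k show "V (Suc k) \<inter> W \<subseteq> V k \<inter> W"
      unfolding V_def by (intro Int_mono subset_ball divide_left_mono order_refl) simp_all
  qed
  ultimately have lim: "(\<lambda>k. emeasure \<xi> (V k \<inter> W)) \<longlonglongrightarrow> emeasure \<xi> {x}"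
    using Lim_emeasure_decseq[of "\<lambda>k. V k \<inter> W" \<xi>] VS fin by (simp add: image_subset_iff less_top)
  have "\<exists>k. emeasure \<xi> (V k \<inter> W) = emeasure \<xi> {x}"
  proof (rule enat_valued_limit_attained[OF lim])
    show "emeasure \<xi> {x} \<le> emeasure \<xi> (V k \<inter> W)" for k
      using V x VS by (intro emeasure_mono) auto
    then show "emeasure \<xi> {x} < \<infinity>" using fin le_less_trans by blast
  qed (use enat VS xS in auto)
  then show ?thesis using V by blast
qed

lemma sym_counting_measuresD:
  assumes "\<xi> \<in> sym_counting_measures L"
  shows "sets \<xi> = sets (restrict_space borel (L \<times> L))" "space \<xi> = L \<times> L"
    and "\<And>A. A \<in> sets \<xi> \<Longrightarrow> emeasure \<xi> A \<in> range ennreal_of_enat"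
    and "\<And>x. x \<in> L \<times> L \<Longrightarrow> \<exists>U. open U \<and> x \<in> U \<and> emeasure \<xi> (U \<inter> L \<times> L) < \<infinity>"
    and "\<And>x. x \<in> L \<times> L \<Longrightarrow> emeasure \<xi> {x} \<noteq> 0 \<Longrightarrow> emeasure \<xi> {x} = 1"
    and "distr \<xi> \<xi> prod.swap = \<xi>"
proof -
  show sets: "sets \<xi> = sets (restrict_space borel (L \<times> L))"
    using assms by (simp add: sym_counting_measures_def)
  show "space \<xi> = L \<times> L"
    using sets_eq_imp_space_eq[OF sets] by (simp add: space_restrict_space)
qed (use assms in \<open>unfold sym_counting_measures_def, blast+\<close>)

definition basis_seq :: "nat \<Rightarrow> 'b::euclidean_space set" where
  "basis_seq = (SOME B. (\<forall>n. open (B n)) \<and> (\<forall>V x. open V \<and> x \<in> V \<longrightarrow> (\<exists>n. x \<in> B n \<and> B n \<subseteq> V)))"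

lemma basis_seq:
  fixes V :: "'b::euclidean_space set"
  shows open_basis_seq: "open (basis_seq n :: 'b set)"
    and basis_seqE: "open V \<Longrightarrow> x \<in> V \<Longrightarrow> \<exists>n. x \<in> basis_seq n \<and> basis_seq n \<subseteq> V"
proof -
  obtain B :: "nat \<Rightarrow> 'b set" where B: "inj B" "\<And>n. open (B n)" "\<And>S. open S \<Longrightarrow> \<exists>k. S = \<Union>{B n |n. n \<in> k}"
    by (rule univ_second_countable_sequence) blast
  have "\<exists>n. x \<in> B n \<and> B n \<subseteq> V" if V: "open V" "x \<in> V" for V x
    using B(3)[OF V(1)] V(2) by blast
  with B(2) have "(\<forall>n. open (B n)) \<and> (\<forall>V x. open V \<and> x \<in> V \<longrightarrow> (\<exists>n. x \<in> B n \<and> B n \<subseteq> V))"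
    by simp
  then have "(\<forall>n. open (basis_seq n :: 'b set)) \<and>
      (\<forall>V x. open V \<and> (x::'b) \<in> V \<longrightarrow> (\<exists>n. x \<in> basis_seq n \<and> basis_seq n \<subseteq> V))"
    unfolding basis_seq_def
    by (rule someI[where P = "\<lambda>B. (\<forall>n. open (B n)) \<and>
      (\<forall>V x. open V \<and> (x::'b) \<in> V \<longrightarrow> (\<exists>n. x \<in> B n \<and> B n \<subseteq> V))"])
  then show "open (basis_seq n :: 'b set)"
    and "open V \<Longrightarrow> x \<in> V \<Longrightarrow> \<exists>n. x \<in> basis_seq n \<and> basis_seq n \<subseteq> V"
    by simp_all
qed

text \<open>Used for both kinds of points: an atom gets a basis set of mass 1 around it, any other
  point a null one.\<close>

lemma sym_counting_measures_basis_nbhd: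
  assumes \<xi>: "\<xi> \<in> sym_counting_measures L" and x: "x \<in> L \<times> L"
  shows "\<exists>j. x \<in> basis_seq j \<and> emeasure \<xi> (basis_seq j \<inter> L \<times> L) = emeasure \<xi> {x}"
proof -
  note [simp] = sym_counting_measuresD(1)[OF \<xi>]
  obtain U where U: "open U" "x \<in> U" "emeasure \<xi> (U \<inter> L \<times> L) < \<infinity>"
    using sym_counting_measuresD(4)[OF \<xi> x] by blast
  obtain V where V: "open V" "x \<in> V" "emeasure \<xi> (V \<inter> L \<times> L) = emeasure \<xi> {x}"
    using open_nbhd_emeasure_singleton[OF sym_counting_measuresD(1,3)[OF \<xi>] x U] by blast
  obtain j where j: "x \<in> basis_seq j" "basis_seq j \<subseteq> V" using basis_seqE[OF V(1,2)] by blast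
  have "emeasure \<xi> (basis_seq j \<inter> L \<times> L) \<le> emeasure \<xi> (V \<inter> L \<times> L)"
    using j V(1) by (intro emeasure_mono) (auto intro!: Int_in_restrict_borel)
  moreover have "emeasure \<xi> {x} \<le> emeasure \<xi> (basis_seq j \<inter> L \<times> L)"
    using j x by (intro emeasure_mono) (auto simp: open_basis_seq intro!: Int_in_restrict_borel)
  ultimately show ?thesis using j V(3) by (auto intro: antisym)
qed

text \<open>Atoms are countable because each has a basis set to itself, and the points that are not
  atoms form a null set because countably many null basis sets cover them. Hence the measure is a
  countable sum of unit masses.\<close>

lemma sym_counting_measures_eq_config:
  fixes \<xi> :: "('a::euclidean_space \<times> 'a) measure"
  assumes \<xi>: "\<xi> \<in> sym_counting_measures L"
  shows "\<xi> = config L (atoms \<xi>)" and "edge_set L (atoms \<xi>)"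
proof -
  note sets = sym_counting_measuresD(1)[OF \<xi>] and space = sym_counting_measuresD(2)[OF \<xi>]
    and locfin = sym_counting_measuresD(4)[OF \<xi>] and simple = sym_counting_measuresD(5)[OF \<xi>]
    and swap = sym_counting_measuresD(6)[OF \<xi>]
  have atoms_sub: "atoms \<xi> \<subseteq> L \<times> L" by (auto simp: atoms_def space)
  have sing: "{x} \<in> sets \<xi>" if "x \<in> L \<times> L" for x
    unfolding sets using that by (rule singleton_in_restrict_borel)
  have basis: "basis_seq j \<inter> L \<times> L \<in> sets \<xi>" for j
    unfolding sets by (intro Int_in_restrict_borel) (simp add: open_basis_seq)
  obtain J where J: "\<And>x. x \<in> L \<times> L \<Longrightarrow> x \<in> basis_seq (J x) \<and> emeasure \<xi> (basis_seq (J x) \<inter> L \<times> L) = emeasure \<xi> {x}"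
    using sym_counting_measures_basis_nbhd[OF \<xi>] by metis
  have atom1: "emeasure \<xi> {x} = 1" if "x \<in> atoms \<xi>" for x
    using that simple[of x] by (auto simp: atoms_def space)
  \<comment> \<open>Two atoms with a common basis set would give it mass at least 2 instead of
    1.\<close>
  have "inj_on J (atoms \<xi>)"
  proof (rule inj_onI, rule ccontr)
    fix x y assume xy: "x \<in> atoms \<xi>" "y \<in> atoms \<xi>" "J x = J y" "x \<noteq> y"
    have "emeasure \<xi> {x} + emeasure \<xi> {y} = emeasure \<xi> ({x} \<union> {y})"
      using xy atoms_sub by (intro plus_emeasure sing) auto
    also have "\<dots> \<le> emeasure \<xi> (basis_seq (J x) \<inter> L \<times> L)"
      using xy atoms_sub J[of x] J[of y] by (intro emeasure_mono basis) auto
    also have "\<dots> = 1" using J[of x] xy atoms_sub atom1 by auto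
    finally show False using xy by (simp add: atom1)
  qed
  then have ctbl: "countable (atoms \<xi>)" by (rule countableI)
  have atoms_sets: "X \<in> sets \<xi>" if "X \<subseteq> atoms \<xi>" for X
  proof -
    have "(\<Union>x\<in>X. {x}) \<in> sets \<xi>"
    proof (rule sets.countable_UN')
      show "countable X" using that ctbl by (rule countable_subset)
      show "(\<lambda>x. {x}) ` X \<subseteq> sets \<xi>" using that atoms_sub sing by blast
    qed
    then show ?thesis by simp
  qed
  \<comment> \<open>\<open>J\<close> takes values in the natural numbers, so the cover of this
    possibly uncountable set is countable.\<close>
  have null: "L \<times> L - atoms \<xi> \<in> null_sets \<xi>"
  proof (rule null_sets_subset)
    show "(\<Union>i\<in>J ` (L \<times> L - atoms \<xi>). basis_seq i \<inter> L \<times> L) \<in> null_sets \<xi>"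
    proof (rule null_sets_UN')
      show "basis_seq i \<inter> L \<times> L \<in> null_sets \<xi>" if i: "i \<in> J ` (L \<times> L - atoms \<xi>)" for i
      proof -
        obtain x where "i = J x" "x \<in> L \<times> L" "x \<notin> atoms \<xi>" using i by (elim imageE DiffE)
        then show ?thesis
          using J[of x] basis[of i] by (simp add: null_sets_def atoms_def space del: Int_iff)
      qed
    qed simp
    show "L \<times> L - atoms \<xi> \<in> sets \<xi>"
      using atoms_sets[of "atoms \<xi>"] sets.top[of \<xi>] space by auto
    show "L \<times> L - atoms \<xi> \<subseteq> (\<Union>i\<in>J ` (L \<times> L - atoms \<xi>). basis_seq i \<inter> L \<times> L)"
      using J by blast
  qed
  have eq: "emeasure \<xi> A = emeasure (count_space UNIV) (A \<inter> atoms \<xi>)" if A: "A \<in> sets \<xi>" for A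
  proof -
    have "A = (A \<inter> atoms \<xi>) \<union> A \<inter> (L \<times> L - atoms \<xi>)"
      using sets.sets_into_space[OF A] space by auto
    moreover have "A \<inter> (L \<times> L - atoms \<xi>) \<in> null_sets \<xi>"
      using null A by (rule null_set_Int1)
    ultimately have "emeasure \<xi> A = emeasure \<xi> (A \<inter> atoms \<xi>)"
      by (metis emeasure_Un_null_set atoms_sets inf_le2)
    also have "\<dots> = (\<integral>\<^sup>+x. emeasure \<xi> {x} \<partial>count_space (A \<inter> atoms \<xi>))"
      using atoms_sub ctbl by (intro emeasure_countable_singleton sing) auto
    also have "\<dots> = (\<integral>\<^sup>+x. 1 \<partial>count_space (A \<inter> atoms \<xi>))"
      by (intro nn_integral_cong) (auto simp: atom1)
    finally show ?thesis by (simp add: emeasure_count_space)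
  qed
  show conf: "\<xi> = config L (atoms \<xi>)"
    using atoms_sub sets by (intro measure_eqI) (auto simp: eq emeasure_config)
  \<comment> \<open>Symmetry of the measure passes to its atoms because \<open>atoms\<close>
    recovers a set from its \<open>config\<close>.\<close>
  have "config L (prod.swap ` atoms \<xi>) = config L (atoms \<xi>)"
    using swap atoms_sub conf by (metis distr_config_swap)
  then have "prod.swap ` atoms \<xi> = atoms \<xi>"
    using atoms_sub atoms_config by (metis prod_swap_image_subset)
  moreover have "\<exists>U. open U \<and> x \<in> U \<and> finite (U \<inter> atoms \<xi>)" if x: "x \<in> L \<times> L" for x
  proof -
    obtain U where U: "open U" "x \<in> U" "emeasure \<xi> (U \<inter> L \<times> L) < \<infinity>" using locfin[OF x] by blast
    have "U \<inter> L \<times> L \<in> sets \<xi>"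
      unfolding sets using U(1) by (intro Int_in_restrict_borel) auto
    then have "finite (U \<inter> L \<times> L \<inter> atoms \<xi>)"
      using U(3) eq by (auto simp: emeasure_count_space split: if_splits)
    moreover have "U \<inter> L \<times> L \<inter> atoms \<xi> = U \<inter> atoms \<xi>" using atoms_sub by auto
    ultimately show ?thesis using U by auto
  qed
  ultimately show "edge_set L (atoms \<xi>)" using atoms_sub by (auto simp: edge_set_def)
qed


section \<open>Coding graphs by sequences\<close>

lemma space_sym_counting_space [simp]: "space (sym_counting_space L) = sym_counting_measures L"
  by (simp add: sym_counting_space_def space_measure_of_conv)

lemma sets_sym_counting_space:
  "sets (sym_counting_space L) = sigma_sets (sym_counting_measures L)
     {(\<lambda>\<xi>. emeasure \<xi> A) -` B \<inter> sym_counting_measures L | A B.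
       A \<in> sets (restrict_space borel (L \<times> L)) \<and> B \<in> sets borel}"
  unfolding sym_counting_space_def by (rule sets_measure_of) blast

lemma measurable_emeasure_sym_counting_space:
  assumes "A \<in> sets (restrict_space borel (L \<times> L))"
  shows "(\<lambda>\<xi>. emeasure \<xi> A) \<in> borel_measurable (sym_counting_space L)"
proof (rule measurableI)
  fix B :: "ennreal set" assume "B \<in> sets borel"
  with assms show "(\<lambda>\<xi>. emeasure \<xi> A) -` B \<inter> space (sym_counting_space L) \<in> sets (sym_counting_space L)"
    unfolding sets_sym_counting_space space_sym_counting_space by (intro sigma_sets.Basic) blast
qed simp

lemma measurable_sym_counting_spaceI:
  assumes "\<And>x. x \<in> space N \<Longrightarrow> f x \<in> sym_counting_measures L"
    and "\<And>A. A \<in> sets (restrict_space borel (L \<times> L)) \<Longrightarrow> (\<lambda>x. emeasure (f x) A) \<in> borel_measurable N"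
  shows "f \<in> measurable N (sym_counting_space L)"
  unfolding sym_counting_space_def
proof (rule measurable_measure_of)
  fix Y assume "Y \<in> {(\<lambda>\<xi>. emeasure \<xi> A) -` B \<inter> sym_counting_measures L | A B.
       A \<in> sets (restrict_space borel (L \<times> L)) \<and> B \<in> sets borel}"
  then obtain A B where Y: "Y = (\<lambda>\<xi>. emeasure \<xi> A) -` B \<inter> sym_counting_measures L"
    and A: "A \<in> sets (restrict_space borel (L \<times> L))" and B: "B \<in> sets borel" by blast
  have "f -` Y \<inter> space N = (\<lambda>x. emeasure (f x) A) -` B \<inter> space N"
    unfolding Y using assms(1) by blast
  then show "f -` Y \<inter> space N \<in> sets N"
    using measurable_sets[OF assms(2)[OF A] B] by simp
qed (use assms(1) in auto)

lemma emeasure_sym_counting_measures: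
  assumes "\<xi> \<in> sym_counting_measures L" "A \<in> sets (restrict_space borel (L \<times> L))"
  shows "emeasure \<xi> A = emeasure (count_space UNIV) (A \<inter> atoms \<xi>)"
proof -
  have "emeasure (config L (atoms \<xi>)) A = emeasure (count_space UNIV) (A \<inter> atoms \<xi>)"
    using sym_counting_measures_eq_config(2)[OF assms(1)] assms(2)
    by (intro emeasure_config) (simp_all add: edge_set_def)
  then show ?thesis
    using sym_counting_measures_eq_config(1)[OF assms(1)] by simp
qed

lemma emeasure_count_space_eq_1_iff:
  "emeasure (count_space UNIV) X = 1 \<longleftrightarrow> (\<exists>x. X = {x})"
proof
  assume X: "emeasure (count_space UNIV) X = 1"
  then have "card X = 1" by (cases "finite X") (simp_all add: emeasure_count_space)
  then show "\<exists>x. X = {x}" by (simp add: card_1_singleton_iff)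
qed (auto simp: emeasure_count_space)

text \<open>The first component distinguishes a basis set without a unique atom from one whose atom is the origin.\<close>
definition edge_code :: "'a::euclidean_space set \<Rightarrow> ('a \<times> 'a) measure \<Rightarrow> nat \<Rightarrow> real \<times> 'a \<times> 'a" where
  "edge_code L \<xi> j = (if emeasure \<xi> (basis_seq j \<inter> L \<times> L) = 1
     then (1, THE x. basis_seq j \<inter> atoms \<xi> = {x}) else (0, 0))"

text \<open>Decoding is applied to arbitrary sequences, whose points may lie anywhere; the
  membership condition keeps the result inside \<open>L \<times> L\<close>.\<close>

definition decode_set :: "'a::euclidean_space set \<Rightarrow> (nat \<Rightarrow> real \<times> 'a \<times> 'a) \<Rightarrow> ('a \<times> 'a) set" where
  "decode_set L z = {snd (z j) | j. fst (z j) = 1 \<and> snd (z j) \<in> L \<times> L}"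

lemma basis_seq_restrict: "basis_seq j \<inter> L \<times> L \<in> sets (restrict_space borel (L \<times> L))"
  by (intro Int_in_restrict_borel) (simp add: open_basis_seq)

lemma edge_code_eq:
  assumes \<xi>: "\<xi> \<in> sym_counting_measures L"
  shows "emeasure \<xi> (basis_seq j \<inter> L \<times> L) = 1 \<longleftrightarrow> (\<exists>x. basis_seq j \<inter> atoms \<xi> = {x})"
    and "basis_seq j \<inter> atoms \<xi> = {x} \<Longrightarrow> edge_code L \<xi> j = (1, x)"
proof -
  have "basis_seq j \<inter> L \<times> L \<inter> atoms \<xi> = basis_seq j \<inter> atoms \<xi>"
    using sym_counting_measures_eq_config(2)[OF \<xi>] by (auto simp: edge_set_def)
  then show *: "emeasure \<xi> (basis_seq j \<inter> L \<times> L) = 1 \<longleftrightarrow> (\<exists>x. basis_seq j \<inter> atoms \<xi> = {x})"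
    by (simp add: emeasure_sym_counting_measures[OF \<xi> basis_seq_restrict] emeasure_count_space_eq_1_iff)
  show "edge_code L \<xi> j = (1, x)" if x: "basis_seq j \<inter> atoms \<xi> = {x}"
  proof -
    have "(THE y. basis_seq j \<inter> atoms \<xi> = {y}) = x" unfolding x by auto
    then show ?thesis using * x by (auto simp: edge_code_def)
  qed
qed

lemma fst_edge_code: "fst (edge_code L \<xi> j) = 1 \<longleftrightarrow> emeasure \<xi> (basis_seq j \<inter> L \<times> L) = 1"
  by (simp add: edge_code_def)

lemma decode_set_edge_code:
  assumes \<xi>: "\<xi> \<in> sym_counting_measures L"
  shows "decode_set L (edge_code L \<xi>) = atoms \<xi>"
proof (intro equalityI subsetI)
  fix x assume "x \<in> decode_set L (edge_code L \<xi>)"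
  then obtain j where j: "fst (edge_code L \<xi> j) = 1" "x = snd (edge_code L \<xi> j)"
    unfolding decode_set_def by blast
  then obtain y where y: "basis_seq j \<inter> atoms \<xi> = {y}"
    using edge_code_eq(1)[OF \<xi>] fst_edge_code by blast
  with j edge_code_eq(2)[OF \<xi> y] show "x \<in> atoms \<xi>" by auto
next
  fix x assume x: "x \<in> atoms \<xi>"
  then have xL: "x \<in> L \<times> L"
    using sym_counting_measures_eq_config(2)[OF \<xi>] by (auto simp: edge_set_def)
  then obtain j where j: "x \<in> basis_seq j" "emeasure \<xi> (basis_seq j \<inter> L \<times> L) = emeasure \<xi> {x}"
    using sym_counting_measures_basis_nbhd[OF \<xi>] by blast
  have "emeasure \<xi> {x} = 1"
    using sym_counting_measuresD(5)[OF \<xi> xL] x by (simp add: atoms_def)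
  then obtain y where y: "basis_seq j \<inter> atoms \<xi> = {y}"
    using edge_code_eq(1)[OF \<xi>, of j] j by auto
  with x j have "y = x" by (metis Int_iff singletonD)
  then have "edge_code L \<xi> j = (1, x)" using edge_code_eq(2)[OF \<xi> y] by simp
  then show "x \<in> decode_set L (edge_code L \<xi>)"
    unfolding decode_set_def using xL by (intro CollectI exI[of _ j]) simp
qed

text \<open>If a basis set holds a single atom, the atom satisfies a Borel condition exactly when
  the part of the basis set cut out by that condition has mass 1. Events about the code thus become
  events about masses.\<close>

lemma measurable_edge_code:
  "edge_code L \<in> measurable (sym_counting_space L) borel"
proof (rule measurable_coordinatewise_then_product)
  fix j
  show "(\<lambda>\<xi>. edge_code L \<xi> j) \<in> borel_measurable (sym_counting_space L)"
  proof (rule measurableI)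
    fix B :: "(real \<times> 'a \<times> 'a) set" assume B: "B \<in> sets borel"
    \<comment> \<open>The points of the basis set that would yield a code in
      \<open>B\<close>.\<close>
    define C where "C = basis_seq j \<inter> Pair (1::real) -` B"
    have "Pair (1::real) \<in> borel_measurable (borel :: ('a \<times> 'a) measure)"
      by (intro borel_measurable_continuous_onI continuous_intros)
    from measurable_sets[OF this B] have "C \<in> sets borel"
      unfolding C_def by (intro sets.Int) (simp_all add: open_basis_seq)
    then have C: "C \<inter> L \<times> L \<in> sets (restrict_space borel (L \<times> L))"
      by (rule Int_in_restrict_borel)
    let ?e = "\<lambda>\<xi>. emeasure \<xi> (basis_seq j \<inter> L \<times> L)"
    note [measurable] = measurable_emeasure_sym_counting_space[OF C]
      measurable_emeasure_sym_counting_space[OF basis_seq_restrict[of j L]]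
    have "(\<lambda>\<xi>. edge_code L \<xi> j) -` B \<inter> space (sym_counting_space L) =
      {\<xi> \<in> space (sym_counting_space L). ?e \<xi> = 1 \<and> emeasure \<xi> (C \<inter> L \<times> L) = 1} \<union>
      {\<xi> \<in> space (sym_counting_space L). ?e \<xi> \<noteq> 1 \<and> (0, 0) \<in> B}" (is "?l = ?r")
    proof (intro set_eqI)
      fix \<xi>
      show "\<xi> \<in> ?l \<longleftrightarrow> \<xi> \<in> ?r"
      proof (cases "\<xi> \<in> sym_counting_measures L \<and> ?e \<xi> = 1")
        case True
        then have \<xi>: "\<xi> \<in> sym_counting_measures L" by simp
        obtain x where x: "basis_seq j \<inter> atoms \<xi> = {x}"
          using True edge_code_eq(1)[OF \<xi>] by blast
        have xa: "x \<in> atoms \<xi>" "x \<in> basis_seq j" using x by blast+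
        have "atoms \<xi> \<subseteq> L \<times> L"
          using sym_counting_measures_eq_config(2)[OF \<xi>] by (simp add: edge_set_def)
        then have "C \<inter> L \<times> L \<inter> atoms \<xi> = (if (1, x) \<in> B then {x} else {})"
          using x unfolding C_def by auto
        then have "emeasure \<xi> (C \<inter> L \<times> L) = 1 \<longleftrightarrow> (1, x) \<in> B"
          by (simp add: emeasure_sym_counting_measures[OF \<xi> C])
        then show ?thesis using True edge_code_eq(2)[OF \<xi> x] by simp
      next
        case False
        then show ?thesis by (auto simp: edge_code_def)
      qed
    qed
    also have "\<dots> \<in> sets (sym_counting_space L)" by measurable
    finally show "(\<lambda>\<xi>. edge_code L \<xi> j) -` B \<inter> space (sym_counting_space L) \<in> sets (sym_counting_space L)" .
  qed simp
qed

lemma measurable_snd_code_coordinate: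
  "(\<lambda>z :: nat \<Rightarrow> real \<times> 'b::euclidean_space. snd (z j)) \<in> borel_measurable borel"
  by (intro borel_measurable_continuous_onI continuous_intros continuous_on_product_coordinates)

text \<open>The number of decoded points is a series of indicators, the \<open>j\<close>-th of which
  depends on finitely many entries of \<open>z\<close>.\<close>

lemma measurable_count_decode_set:
  fixes L :: "'a::euclidean_space set"
  assumes A: "A \<in> sets borel" and L: "open L"
  shows "(\<lambda>z. emeasure (count_space UNIV) (A \<inter> decode_set L z)) \<in> borel_measurable borel"
proof -
  define D where "D = A \<inter> L \<times> L"
  have D[measurable]: "D \<in> sets borel" unfolding D_def using A L by (simp add: open_Times)
  define Q where "Q i z \<longleftrightarrow> fst (z i) = 1" for i and z :: "nat \<Rightarrow> real \<times> 'a \<times> 'a"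
  define R where "R i j z \<longleftrightarrow> snd (z i) = snd (z j)" for i j and z :: "nat \<Rightarrow> real \<times> 'a \<times> 'a"
  define S where "S i z \<longleftrightarrow> snd (z i) \<in> D" for i and z :: "nat \<Rightarrow> real \<times> 'a \<times> 'a"
  have "closed {z. Q i z}" "closed {z. R i j z}" for i j
    unfolding Q_def R_def
    by (intro closed_Collect_eq continuous_intros continuous_on_product_coordinates)+
  then have [measurable]: "Measurable.pred borel (Q i)" "Measurable.pred borel (R i j)" for i j
    unfolding pred_def by simp_all
  have [measurable]: "Measurable.pred borel (S i)" for i
    unfolding S_def using measurable_snd_code_coordinate by (rule pred_sets2[OF D])
  \<comment> \<open>a point occurring several times in \<open>z\<close> is counted at its first occurrence only\<close>
  define P where "P j z \<longleftrightarrow> fst (z j) = 1 \<and> snd (z j) \<in> D \<and>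
      (\<forall>i\<in>{..<j}. \<not> (fst (z i) = 1 \<and> snd (z i) = snd (z j)))" for j and z :: "nat \<Rightarrow> real \<times> 'a \<times> 'a"
  define F where "F j z = (if P j z then {snd (z j)} else {})" for j z
  have [measurable]: "Measurable.pred borel (P j)" for j
    unfolding P_def Q_def[symmetric] R_def[symmetric] S_def[symmetric] by measurable
  have "emeasure (count_space UNIV) (A \<inter> decode_set L z) = (\<Sum>j. indicator {z. P j z} z)" for z
  proof -
    have "A \<inter> decode_set L z = (\<Union>j. F j z)"
    proof (intro equalityI subsetI)
      fix x assume x: "x \<in> A \<inter> decode_set L z"
      then have xD: "x \<in> D" unfolding decode_set_def D_def by blast
      have ex: "\<exists>j. fst (z j) = 1 \<and> snd (z j) = x" using x unfolding decode_set_def by blast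
      define j where "j = (LEAST j. fst (z j) = 1 \<and> snd (z j) = x)"
      have "fst (z j) = 1 \<and> snd (z j) = x" unfolding j_def using ex by (rule LeastI_ex)
      moreover have "\<not> (fst (z i) = 1 \<and> snd (z i) = x)" if "i < j" for i
        using that unfolding j_def by (rule not_less_Least)
      ultimately have "x \<in> F j z" using xD by (auto simp: F_def P_def)
      then show "x \<in> (\<Union>j. F j z)" by blast
    next
      fix x assume "x \<in> (\<Union>j. F j z)"
      then obtain j where "x = snd (z j)" "P j z" by (auto simp: F_def split: if_splits)
      then have "fst (z j) = 1" "snd (z j) \<in> A" "snd (z j) \<in> L \<times> L"
        by (simp_all add: P_def D_def)
      with \<open>x = snd (z j)\<close> show "x \<in> A \<inter> decode_set L z"
        unfolding decode_set_def by (intro IntI CollectI exI[of _ j]) simp_all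
    qed
    moreover have "F i z \<inter> F j z = {}" if "i < j" for i j
    proof -
      have "\<not> (P i z \<and> P j z \<and> snd (z i) = snd (z j))"
        using that unfolding P_def lessThan_iff[symmetric] by blast
      then show ?thesis by (auto simp: F_def)
    qed
    then have "disjoint_family (\<lambda>j. F j z)"
      unfolding disjoint_family_on_def by (metis Int_commute neq_iff)
    ultimately have "emeasure (count_space UNIV) (A \<inter> decode_set L z) = (\<Sum>j. emeasure (count_space UNIV) (F j z))"
      by (simp add: suminf_emeasure)
    also have "\<dots> = (\<Sum>j. indicator {z. P j z} z)"
      by (intro suminf_cong) (simp add: F_def emeasure_count_space_eq_1_iff)
    finally show ?thesis .
  qed
  then show ?thesis by simp
qed


section \<open>Measurable decoding of arbitrary sequences\<close>

definition decodable :: "'a::euclidean_space set \<Rightarrow> (nat \<Rightarrow> real \<times> 'a \<times> 'a) \<Rightarrow> bool" where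
  "decodable L z \<longleftrightarrow> edge_set L (decode_set L z)"

lemma edge_set_empty: "edge_set L {}"
  by (auto simp: edge_set_def)

lemma decodable_edge_code:
  "\<xi> \<in> sym_counting_measures L \<Longrightarrow> decodable L (edge_code L \<xi>)"
  using sym_counting_measures_eq_config(2) by (simp add: decodable_def decode_set_edge_code)

text \<open>Replaces local finiteness, a condition on uncountably many points, by countably many
  conditions that can be measured. One direction is a finite subcover; in the other, the interior of
  the next compact set is the required neighbourhood.\<close>

lemma edge_set_iff_finite_compact:
  fixes L :: "'a::euclidean_space set"
  assumes C: "\<And>n. compact (C n)" "\<And>n. C n \<subseteq> L \<times> L" "\<And>n. C n \<subseteq> interior (C (Suc n))"
    "\<Union>(range C) = L \<times> L"
  shows "edge_set L T \<longleftrightarrow> T \<subseteq> L \<times> L \<and> prod.swap ` T = T \<and> (\<forall>n. finite (C n \<inter> T))"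
proof -
  have "(\<forall>x\<in>L \<times> L. \<exists>U. open U \<and> x \<in> U \<and> finite (U \<inter> T)) \<longleftrightarrow> (\<forall>n. finite (C n \<inter> T))"
  proof (intro iffI allI ballI)
    fix n assume loc: "\<forall>x\<in>L \<times> L. \<exists>U. open U \<and> x \<in> U \<and> finite (U \<inter> T)"
    have "C n \<subseteq> \<Union>{U. open U \<and> finite (U \<inter> T)}"
    proof
      fix x assume "x \<in> C n"
      then have "x \<in> L \<times> L" using C(2) by blast
      with loc show "x \<in> \<Union>{U. open U \<and> finite (U \<inter> T)}" by blast
    qed
    then obtain \<U> where \<U>: "\<U> \<subseteq> {U. open U \<and> finite (U \<inter> T)}" "finite \<U>" "C n \<subseteq> \<Union>\<U>"
      using compactE[OF C(1)] by (metis (no_types, lifting) mem_Collect_eq)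
    have "finite (\<Union>U\<in>\<U>. U \<inter> T)" using \<U>(1,2) by blast
    then show "finite (C n \<inter> T)" by (rule rev_finite_subset) (use \<U>(3) in blast)
  next
    fix x assume fin: "\<forall>n. finite (C n \<inter> T)" and "x \<in> L \<times> L"
    then obtain n where "x \<in> C n" using C(4) by blast
    then have "x \<in> interior (C (Suc n))" using C(3) by blast
    moreover have "finite (interior (C (Suc n)) \<inter> T)"
      using fin interior_subset[of "C (Suc n)"] by (meson Int_mono order_refl rev_finite_subset)
    ultimately show "\<exists>U. open U \<and> x \<in> U \<and> finite (U \<inter> T)" by blast
  qed
  then show ?thesis by (simp only: edge_set_def)
qed

text \<open>For a decoded set, finiteness on a compact exhaustion and symmetry are both countable
  combinations of Borel conditions on the entries.\<close>

lemma sets_decodable: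
  fixes L :: "'a::euclidean_space set"
  assumes L: "open L"
  shows "{z. decodable L z} \<in> sets borel"
proof -
  obtain C :: "nat \<Rightarrow> ('a \<times> 'a) set" where C: "\<And>n. compact (C n)" "\<And>n. C n \<subseteq> L \<times> L"
    "\<And>n. C n \<subseteq> interior (C (Suc n))" "\<Union>(range C) = L \<times> L"
    by (rule open_Union_compact_subsets[OF open_Times[OF L L]]) blast
  define V where "V i = {z :: nat \<Rightarrow> real \<times> 'a \<times> 'a. fst (z i) = 1}" for i
  define W where "W i = {z :: nat \<Rightarrow> real \<times> 'a \<times> 'a. snd (z i) \<in> L \<times> L}" for i
  define R where "R i j = {z :: nat \<Rightarrow> real \<times> 'a \<times> 'a.
      snd (z i) = (snd (snd (z j)), fst (snd (z j)))}" for i j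
  define F where "F n = {z. emeasure (count_space UNIV) (C n \<inter> decode_set L z) < \<infinity>}" for n
  have [measurable]: "V i \<in> sets borel" "R i j \<in> sets borel" for i j
    unfolding V_def R_def
    by (intro borel_closed closed_Collect_eq continuous_intros continuous_on_product_coordinates)+
  have [measurable]: "W i \<in> sets borel" for i
    using measurable_sets[OF measurable_snd_code_coordinate, of "L \<times> L" i] L
    by (simp add: W_def vimage_def open_Times)
  have [measurable]: "F n \<in> sets borel" for n
    unfolding F_def using measurable_count_decode_set[OF borel_compact[OF C(1)] L, of n] by measurable
  have sub: "decode_set L z \<subseteq> L \<times> L" for z unfolding decode_set_def by blast
  have fin: "finite (C n \<inter> decode_set L z) \<longleftrightarrow> z \<in> F n" for n z
    by (simp add: F_def emeasure_count_space of_nat_less_top)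
  \<comment> \<open>Symmetry read off the entries: every valid entry \<open>j\<close> has a partner
    \<open>i\<close> carrying the swapped point. Only \<open>j\<close> is tested for
    \<open>W\<close>, since \<open>L \<times> L\<close> is itself symmetric.\<close>
  have swap: "prod.swap ` decode_set L z = decode_set L z \<longleftrightarrow> z \<in> (\<Inter>j. - (V j \<inter> W j) \<union> (\<Union>i. V i \<inter> R i j))" for z
  proof -
    \<comment> \<open>One inclusion suffices because the swap is an involution.\<close>
    have "prod.swap ` decode_set L z = decode_set L z \<longleftrightarrow> (\<forall>x\<in>decode_set L z. prod.swap x \<in> decode_set L z)"
      by (auto simp: image_iff) (metis swap_simp)+
    also have "\<dots> \<longleftrightarrow> (\<forall>j. fst (z j) = 1 \<and> snd (z j) \<in> L \<times> L \<longrightarrow> 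
        (\<exists>i. fst (z i) = 1 \<and> snd (z i) = prod.swap (snd (z j))))"
    proof -
      have mem: "x \<in> decode_set L z \<longleftrightarrow> x \<in> L \<times> L \<and> (\<exists>j. fst (z j) = 1 \<and> snd (z j) = x)" for x
        unfolding decode_set_def mem_Collect_eq by metis
      have swap_L: "prod.swap x \<in> L \<times> L \<longleftrightarrow> x \<in> L \<times> L" for x
        by (cases x) auto
      show ?thesis
      proof (intro iffI allI ballI impI)
        fix j assume all: "\<forall>x\<in>decode_set L z. prod.swap x \<in> decode_set L z"
          and "fst (z j) = 1 \<and> snd (z j) \<in> L \<times> L"
        then have "snd (z j) \<in> decode_set L z" unfolding mem by (intro conjI exI[of _ j]) simp_all
        with all have "prod.swap (snd (z j)) \<in> decode_set L z" by (rule bspec)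
        then show "\<exists>i. fst (z i) = 1 \<and> snd (z i) = prod.swap (snd (z j))" unfolding mem by (rule conjunct2)
      next
        fix x assume all: "\<forall>j. fst (z j) = 1 \<and> snd (z j) \<in> L \<times> L \<longrightarrow>
            (\<exists>i. fst (z i) = 1 \<and> snd (z i) = prod.swap (snd (z j)))" and x: "x \<in> decode_set L z"
        from x obtain j where j: "fst (z j) = 1" "snd (z j) = x" unfolding mem by (elim conjE exE)
        moreover have "x \<in> L \<times> L" using x unfolding mem by (rule conjunct1)
        ultimately show "prod.swap x \<in> decode_set L z"
          using all[THEN spec, of j] unfolding mem swap_L by simp
      qed
    qed
    finally have "prod.swap ` decode_set L z = decode_set L z \<longleftrightarrow> (\<forall>j. z \<in> V j \<inter> W j \<longrightarrow> (\<exists>i. z \<in> V i \<inter> R i j))"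
      by (simp add: V_def W_def R_def prod.swap_def)
    then show ?thesis by blast
  qed
  have "{z. decodable L z} = (\<Inter>n. F n) \<inter> (\<Inter>j. - (V j \<inter> W j) \<union> (\<Union>i. V i \<inter> R i j))"
    unfolding decodable_def edge_set_iff_finite_compact[OF C] fin swap using sub by simp blast
  also have "\<dots> \<in> sets borel" by measurable
  finally show ?thesis .
qed

text \<open>Sequences that do not decode are sent to the empty graph, so that every value is a graph
  on \<open>L\<close> when \<open>L\<close> is open.\<close>

definition decode :: "'a::euclidean_space set \<Rightarrow> (nat \<Rightarrow> real \<times> 'a \<times> 'a) \<Rightarrow> ('a \<times> 'a) measure" where
  "decode L z = config L (if decodable L z then decode_set L z else {})"

lemma decode_edge_code:
  assumes "\<xi> \<in> sym_counting_measures L"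
  shows "decode L (edge_code L \<xi>) = \<xi>"
  using assms sym_counting_measures_eq_config(1)[OF assms]
  by (simp add: decode_def decodable_edge_code decode_set_edge_code)

text \<open>A common criterion for decoding and for gluing. As \<open>L\<close> is open, testing on
  ambient Borel sets inside \<open>L \<times> L\<close> covers all Borel sets of the
  subspace.\<close>

lemma measurable_config:
  assumes "open L"
    and "\<And>x. x \<in> space N \<Longrightarrow> edge_set L (T x)"
    and "\<And>A. A \<in> sets borel \<Longrightarrow> A \<subseteq> L \<times> L \<Longrightarrow>
      (\<lambda>x. emeasure (count_space UNIV) (A \<inter> T x)) \<in> borel_measurable N"
  shows "(\<lambda>x. config L (T x)) \<in> measurable N (sym_counting_space L)"
proof (rule measurable_sym_counting_spaceI)
  show "config L (T x) \<in> sym_counting_measures L" if "x \<in> space N" for x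
    using assms(1) assms(2)[OF that] by (rule config_in_sym_counting_measures)
  fix A assume A: "A \<in> sets (restrict_space borel (L \<times> L))"
  have AL: "A \<subseteq> L \<times> L" using A by (rule sets_restrict_borel_subset)
  have "A \<in> sets borel"
    using A assms(1) by (subst (asm) sets_restrict_space_iff) (simp_all add: open_Times)
  from assms(3)[OF this AL] show "(\<lambda>x. emeasure (config L (T x)) A) \<in> borel_measurable N"
    by (rule measurable_cong[THEN iffD1, rotated])
      (use assms(2) A in \<open>simp add: emeasure_config edge_set_def\<close>)
qed

lemma measurable_decode:
  assumes "open L"
  shows "decode L \<in> measurable borel (sym_counting_space L)"
  unfolding decode_def
proof (rule measurable_config[OF assms])
  show "edge_set L (if decodable L z then decode_set L z else {})" for z
    by (simp add: decodable_def edge_set_empty)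
  fix A :: "('a \<times> 'a) set" assume A: "A \<in> sets borel"
  have "(\<lambda>z. if decodable L z then emeasure (count_space UNIV) (A \<inter> decode_set L z) else 0) \<in> borel_measurable borel"
    using sets_decodable[OF assms] measurable_count_decode_set[OF A assms]
    by (intro measurable_If) simp_all
  then show "(\<lambda>z. emeasure (count_space UNIV) (A \<inter> (if decodable L z then decode_set L z else {})))
      \<in> borel_measurable borel"
    by (rule back_subst[where P = "\<lambda>f. f \<in> borel_measurable borel"]) auto
qed


section \<open>Restriction and gluing\<close>

lemma edge_set_restrict:
  assumes "edge_set L T" "K \<subseteq> L"
  shows "edge_set K (T \<inter> K \<times> K)"
proof -
  have "prod.swap ` (T \<inter> K \<times> K) = prod.swap ` T \<inter> K \<times> K" by auto
  then have "prod.swap ` (T \<inter> K \<times> K) = T \<inter> K \<times> K"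
    using assms(1) by (simp add: edge_set_def)
  moreover have "\<exists>U. open U \<and> x \<in> U \<and> finite (U \<inter> (T \<inter> K \<times> K))" if "x \<in> K \<times> K" for x
  proof -
    have "x \<in> L \<times> L" using that assms(2) by blast
    then obtain U where "open U" "x \<in> U" "finite (U \<inter> T)"
      using assms(1) unfolding edge_set_def by blast
    moreover have "U \<inter> (T \<inter> K \<times> K) \<subseteq> U \<inter> T" by blast
    ultimately show ?thesis using finite_subset by blast
  qed
  ultimately show ?thesis by (simp add: edge_set_def)
qed

lemma restrict_graph_eq_config:
  assumes "\<xi> \<in> sym_counting_measures L" "open K" "K \<subseteq> L"
  shows "restrict_graph K \<xi> = config K (atoms \<xi> \<inter> K \<times> K)"
    and "edge_set K (atoms \<xi> \<inter> K \<times> K)"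
    and "restrict_graph K \<xi> \<in> sym_counting_measures K"
    and "atoms (restrict_graph K \<xi>) = atoms \<xi> \<inter> K \<times> K"
proof -
  note \<xi> = sym_counting_measures_eq_config[OF assms(1)]
  have "atoms \<xi> \<subseteq> L \<times> L" using \<xi>(2) by (simp add: edge_set_def)
  from restrict_graph_config[OF assms(2,3) this]
  show *: "restrict_graph K \<xi> = config K (atoms \<xi> \<inter> K \<times> K)" using \<xi>(1) by simp
  show **: "edge_set K (atoms \<xi> \<inter> K \<times> K)" using \<xi>(2) assms(3) by (rule edge_set_restrict)
  show "restrict_graph K \<xi> \<in> sym_counting_measures K"
    unfolding * using assms(2) ** by (rule config_in_sym_counting_measures)
  show "atoms (restrict_graph K \<xi>) = atoms \<xi> \<inter> K \<times> K"
    unfolding * by (rule atoms_config) blast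
qed

text \<open>Reduces identities between restricted or rotated graphs to set algebra on their
  atoms.\<close>

lemma sym_counting_measures_eqI:
  assumes "\<xi> \<in> sym_counting_measures L" "\<zeta> \<in> sym_counting_measures L" "atoms \<xi> = atoms \<zeta>"
  shows "\<xi> = \<zeta>"
  using assms(3) sym_counting_measures_eq_config(1)[OF assms(1)]
    sym_counting_measures_eq_config(1)[OF assms(2)] by simp

lemma restrict_graph_restrict_graph:
  assumes "\<xi> \<in> sym_counting_measures H" "open K" "open L" "K \<subseteq> L" "L \<subseteq> H"
  shows "restrict_graph K (restrict_graph L \<xi>) = restrict_graph K \<xi>"
proof (rule sym_counting_measures_eqI)
  note L = restrict_graph_eq_config[OF assms(1,3,5)]
  have "K \<subseteq> H" using assms by blast
  note K = restrict_graph_eq_config[OF assms(1,2) this]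
  note KL = restrict_graph_eq_config[OF L(3) assms(2,4)]
  show "restrict_graph K (restrict_graph L \<xi>) \<in> sym_counting_measures K" by (rule KL(3))
  show "restrict_graph K \<xi> \<in> sym_counting_measures K" by (rule K(3))
  show "atoms (restrict_graph K (restrict_graph L \<xi>)) = atoms (restrict_graph K \<xi>)"
    unfolding KL(4) L(4) K(4) using assms(4) by blast
qed

lemma restrict_graph_self:
  assumes "\<xi> \<in> sym_counting_measures L" "open L"
  shows "restrict_graph L \<xi> = \<xi>"
proof (rule sym_counting_measures_eqI)
  note L = restrict_graph_eq_config[OF assms order_refl]
  show "restrict_graph L \<xi> \<in> sym_counting_measures L" by (rule L(3))
  show "atoms (restrict_graph L \<xi>) = atoms \<xi>"
    unfolding L(4) using sym_counting_measures_eq_config(2)[OF assms(1)] by (auto simp: edge_set_def)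
qed fact

lemma emeasure_restrict_graph:
  assumes "\<xi> \<in> sym_counting_measures L" "open K" "K \<subseteq> L" "A \<in> sets borel" "A \<subseteq> K \<times> K"
  shows "emeasure (restrict_graph K \<xi>) A = emeasure \<xi> A"
proof -
  note K = restrict_graph_eq_config[OF assms(1-3)]
  have "A = A \<inter> K \<times> K" "A = A \<inter> L \<times> L" using assms(3,5) by blast+
  then have A: "A \<in> sets (restrict_space borel (K \<times> K))" "A \<in> sets (restrict_space borel (L \<times> L))"
    using Int_in_restrict_borel[OF assms(4)] by metis+
  have "A \<inter> (atoms \<xi> \<inter> K \<times> K) = A \<inter> atoms \<xi>" using assms(5) by blast
  then show ?thesis
    by (simp only: emeasure_sym_counting_measures[OF K(3) A(1)]
        emeasure_sym_counting_measures[OF assms(1) A(2)] K(4))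
qed

lemma measurable_restrict_graph:
  assumes "open K" "K \<subseteq> L"
  shows "restrict_graph K \<in> measurable (sym_counting_space L) (sym_counting_space K)"
proof (rule measurable_sym_counting_spaceI)
  fix A assume A: "A \<in> sets (restrict_space borel (K \<times> K))"
  have AK: "A \<subseteq> K \<times> K" using A by (rule sets_restrict_borel_subset)
  have AB: "A \<in> sets borel"
    using A assms(1) by (subst (asm) sets_restrict_space_iff) (simp_all add: open_Times)
  have "A = A \<inter> L \<times> L" using AK assms(2) by blast
  then have "A \<in> sets (restrict_space borel (L \<times> L))"
    using Int_in_restrict_borel[OF AB] by metis
  from measurable_emeasure_sym_counting_space[OF this]
  show "(\<lambda>\<xi>. emeasure (restrict_graph K \<xi>) A) \<in> borel_measurable (sym_counting_space L)"
    by (rule measurable_cong[THEN iffD1, rotated])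
      (simp add: emeasure_restrict_graph[OF _ assms AB AK])
qed (simp add: restrict_graph_eq_config(3)[OF _ assms])

text \<open>The set is the preimage of the diagonal, closed in a Hausdorff space, under the pair
  map, Borel by second countability. It will make coherence of codes an event.\<close>

lemma sets_Collect_eq_borel:
  fixes f g :: "'m \<Rightarrow> 'b::{second_countable_topology, t2_space}"
  assumes "f \<in> borel_measurable M" "g \<in> borel_measurable M"
  shows "{x \<in> space M. f x = g x} \<in> sets M"
proof -
  have "closed {y :: 'b \<times> 'b. fst y = snd y}"
    by (intro closed_Collect_eq continuous_intros)
  then have "{y :: 'b \<times> 'b. fst y = snd y} \<in> sets borel" by (rule borel_closed)
  from measurable_sets[OF borel_measurable_Pair[OF assms] this]
  show ?thesis by (rule back_subst[where P = "\<lambda>X. X \<in> sets M"]) auto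
qed

section \<open>Graphs on the whole space seen through an open exhaustion\<close>

locale graph_exhaustion =
  fixes L :: "nat \<Rightarrow> 'a::euclidean_space set"
  assumes open_L: "open (L n)" and incseq_L: "incseq L" and UN_L: "(\<Union>n. L n) = UNIV"
begin

lemma L_mono: "n \<le> m \<Longrightarrow> L n \<subseteq> L m"
  using incseq_L by (rule incseqD)

lemma UN_L_Times: "(\<Union>n. L n \<times> L n) = UNIV"
proof (intro equalityI subsetI)
  fix x :: "'a \<times> 'a"
  obtain i j where "fst x \<in> L i" "snd x \<in> L j" using UN_L by blast
  then have "fst x \<in> L (max i j)" "snd x \<in> L (max i j)" 
    using L_mono[of i "max i j"] L_mono[of j "max i j"] by auto
  then show "x \<in> (\<Union>n. L n \<times> L n)" by (auto simp: mem_Times_iff)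
qed simp

text \<open>Continuity from below along the windows \<open>L n \<times> L n\<close>.\<close>

lemma emeasure_eq_SUP_restrict_graph:
  assumes \<xi>: "\<xi> \<in> sym_counting_measures UNIV" and A: "A \<in> sets borel"
  shows "emeasure \<xi> A = (SUP n. emeasure (restrict_graph (L n) \<xi>) (A \<inter> L n \<times> L n))"
proof -
  have sets: "sets \<xi> = sets borel" using sym_counting_measuresD(1)[OF \<xi>] by simp
  have An: "A \<inter> L n \<times> L n \<in> sets borel" for n
    using A open_L by (simp add: open_Times)
  have "incseq (\<lambda>n. A \<inter> L n \<times> L n)"
    unfolding incseq_def using L_mono by blast
  then have "(SUP n. emeasure \<xi> (A \<inter> L n \<times> L n)) = emeasure \<xi> (\<Union>n. A \<inter> L n \<times> L n)"
    using An by (intro SUP_emeasure_incseq) (auto simp: sets)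
  also have "(\<Union>n. A \<inter> L n \<times> L n) = A"
    by (simp only: Int_UN_distrib[symmetric] UN_L_Times Int_UNIV_right)
  finally have "emeasure \<xi> A = (SUP n. emeasure \<xi> (A \<inter> L n \<times> L n))" by simp
  also have "\<dots> = (SUP n. emeasure (restrict_graph (L n) \<xi>) (A \<inter> L n \<times> L n))"
    by (intro SUP_cong refl emeasure_restrict_graph[OF \<xi> open_L _ An, symmetric]) auto
  finally show ?thesis .
qed

text \<open>The number of edges in a Borel set is the supremum of the numbers seen in the windows,
  so events pulled back from windows already generate everything. This supplies the generator for
  uniqueness.\<close>

lemma sets_sym_counting_space_UNIV:
  "sets (sym_counting_space UNIV) = sigma_sets (sym_counting_measures UNIV)
    {restrict_graph (L n) -` B \<inter> sym_counting_measures UNIV |n B. B \<in> sets (sym_counting_space (L n))}"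
    (is "_ = sigma_sets ?\<Omega> ?E")
proof (intro equalityI subsetI)
  fix X assume X: "X \<in> sets (sym_counting_space (UNIV :: 'a set))"
  have E: "?E \<subseteq> Pow ?\<Omega>" by blast
  define N where "N = sigma ?\<Omega> ?E"
  have sN: "space N = ?\<Omega>" "sets N = sigma_sets ?\<Omega> ?E"
    unfolding N_def using E by (simp_all add: space_measure_of_conv sets_measure_of)
  have r: "restrict_graph (L n) \<in> measurable N (sym_counting_space (L n))" for n
  proof (rule measurableI)
    show "restrict_graph (L n) \<xi> \<in> space (sym_counting_space (L n))" if "\<xi> \<in> space N" for \<xi>
      using restrict_graph_eq_config(3)[OF _ open_L subset_UNIV] that sN by simp
    show "restrict_graph (L n) -` B \<inter> space N \<in> sets N" if "B \<in> sets (sym_counting_space (L n))" for B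
      unfolding sN using that by (intro sigma_sets.Basic) blast
  qed
  \<comment> \<open>Measurability of the identity from the generated sigma-algebra is the wanted
    inclusion.\<close>
  have "(\<lambda>\<xi>. \<xi>) \<in> measurable N (sym_counting_space UNIV)"
  proof (rule measurable_sym_counting_spaceI)
    fix A :: "('a \<times> 'a) set" assume "A \<in> sets (restrict_space borel (UNIV \<times> UNIV))"
    then have A: "A \<in> sets borel" by simp
    have "(\<lambda>\<xi>. SUP n. emeasure (restrict_graph (L n) \<xi>) (A \<inter> L n \<times> L n)) \<in> borel_measurable N"
    proof (intro borel_measurable_SUP)
      fix n
      show "(\<lambda>\<xi>. emeasure (restrict_graph (L n) \<xi>) (A \<inter> L n \<times> L n)) \<in> borel_measurable N"
        using measurable_compose[OF r measurable_emeasure_sym_counting_space[OF Int_in_restrict_borel[OF A]]] .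
    qed simp
    then show "(\<lambda>\<xi>. emeasure \<xi> A) \<in> borel_measurable N"
      by (rule measurable_cong[THEN iffD1, rotated])
        (simp add: sN emeasure_eq_SUP_restrict_graph[OF _ A])
  qed (simp add: sN)
  from measurable_sets[OF this X] have "X \<inter> ?\<Omega> \<in> sigma_sets ?\<Omega> ?E" by (simp add: sN)
  moreover have "X \<subseteq> ?\<Omega>" using sets.sets_into_space[OF X] by simp
  ultimately show "X \<in> sigma_sets ?\<Omega> ?E" by (simp add: Int_absorb2)
next
  fix X assume "X \<in> sigma_sets ?\<Omega> ?E"
  moreover have "?E \<subseteq> sets (sym_counting_space UNIV)"
    using measurable_sets[OF measurable_restrict_graph[OF open_L subset_UNIV]] by auto
  then have "sigma_sets ?\<Omega> ?E \<subseteq> sets (sym_counting_space UNIV)"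
    using sets.sigma_sets_subset[of ?E "sym_counting_space UNIV"] by simp
  ultimately show "X \<in> sets (sym_counting_space UNIV)" by blast
qed

text \<open>Events seen in one window form a generator stable under intersection, and both laws
  agree on it by assumption.\<close>

lemma random_graph_UNIV_eqI:
  assumes \<nu>: "random_graph UNIV \<nu>" "random_graph UNIV \<nu>'"
    and eq: "\<And>n. distr \<nu> (sym_counting_space (L n)) (restrict_graph (L n)) =
      distr \<nu>' (sym_counting_space (L n)) (restrict_graph (L n))"
  shows "\<nu> = \<nu>'"
proof -
  let ?\<Omega> = "sym_counting_measures (UNIV :: 'a set)"
  let ?E = "{restrict_graph (L n) -` B \<inter> ?\<Omega> |n B. B \<in> sets (sym_counting_space (L n))}"
  have sets: "sets \<nu> = sets (sym_counting_space UNIV)" "sets \<nu>' = sets (sym_counting_space UNIV)"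
    using \<nu> by (simp_all add: random_graph_def)
  have space: "space \<nu> = ?\<Omega>" "space \<nu>' = ?\<Omega>"
    using sets[THEN sets_eq_imp_space_eq] by simp_all
  have m: "restrict_graph (L n) \<in> measurable \<nu> (sym_counting_space (L n))"
    "restrict_graph (L n) \<in> measurable \<nu>' (sym_counting_space (L n))" for n
    using measurable_restrict_graph[OF open_L subset_UNIV]
    by (simp_all cong: measurable_cong_sets add: sets)
  interpret \<nu>: prob_space \<nu> using \<nu> by (simp add: random_graph_def)
  show ?thesis
  proof (rule measure_eqI_generator_eq)
    show "Int_stable ?E"
    proof (rule Int_stableI)
      fix X Y assume "X \<in> ?E" "Y \<in> ?E"
      then obtain n m B C where X: "X = restrict_graph (L n) -` B \<inter> ?\<Omega>" "B \<in> sets (sym_counting_space (L n))"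
        and Y: "Y = restrict_graph (L m) -` C \<inter> ?\<Omega>" "C \<in> sets (sym_counting_space (L m))" by blast
      \<comment> \<open>The larger of the two windows sees both events, so their intersection is
        again an event of a single window.\<close>
      define k where "k = max n m"
      have k: "n \<le> k" "m \<le> k" by (simp_all add: k_def)
      define B' where "B' i Z = restrict_graph (L i) -` Z \<inter> space (sym_counting_space (L k))" for i Z
      have B': "B' i Z \<in> sets (sym_counting_space (L k))"
        if "i \<le> k" "Z \<in> sets (sym_counting_space (L i))" for i Z
        unfolding B'_def using measurable_restrict_graph[OF open_L L_mono[OF that(1)]] that(2)
        by (rule measurable_sets)
      have pull: "restrict_graph (L i) -` Z \<inter> ?\<Omega> = restrict_graph (L k) -` B' i Z \<inter> ?\<Omega>" if i: "i \<le> k" for i Z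
      proof (intro set_eqI)
        fix \<xi>
        show "\<xi> \<in> restrict_graph (L i) -` Z \<inter> ?\<Omega> \<longleftrightarrow> \<xi> \<in> restrict_graph (L k) -` B' i Z \<inter> ?\<Omega>"
        proof (cases "\<xi> \<in> ?\<Omega>")
          case True
          then show ?thesis
            using restrict_graph_eq_config(3)[OF True open_L[of k] subset_UNIV]
              restrict_graph_restrict_graph[OF True open_L open_L L_mono[OF i] subset_UNIV]
            by (simp add: B'_def)
        qed simp
      qed
      have "X \<inter> Y = (restrict_graph (L k) -` B' n B \<inter> ?\<Omega>) \<inter> (restrict_graph (L k) -` B' m C \<inter> ?\<Omega>)"
        unfolding X(1) Y(1) pull[OF k(1)] pull[OF k(2)] ..
      also have "\<dots> = restrict_graph (L k) -` (B' n B \<inter> B' m C) \<inter> ?\<Omega>"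
        by (simp only: vimage_Int Int_ac Int_left_absorb)
      finally have "X \<inter> Y = restrict_graph (L k) -` (B' n B \<inter> B' m C) \<inter> ?\<Omega>" .
      moreover have "B' n B \<inter> B' m C \<in> sets (sym_counting_space (L k))"
        using B' k X(2) Y(2) by blast
      ultimately show "X \<inter> Y \<in> ?E" by blast
    qed
    show "emeasure \<nu> X = emeasure \<nu>' X" if XE: "X \<in> ?E" for X
    proof -
      obtain n B where X: "X = restrict_graph (L n) -` B \<inter> ?\<Omega>" "B \<in> sets (sym_counting_space (L n))"
        using XE unfolding mem_Collect_eq by (elim exE conjE)
      have "emeasure \<nu> X = emeasure (distr \<nu> (sym_counting_space (L n)) (restrict_graph (L n))) B"
        using emeasure_distr[OF m(1) X(2)] by (simp add: X(1) space)
      also have "\<dots> = emeasure \<nu>' X"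
        unfolding eq using emeasure_distr[OF m(2) X(2)] by (simp add: X(1) space)
      finally show ?thesis .
    qed
    show "sets \<nu> = sigma_sets ?\<Omega> ?E" "sets \<nu>' = sigma_sets ?\<Omega> ?E"
      unfolding sets by (rule sets_sym_counting_space_UNIV)+
    \<comment> \<open>The whole space is itself an event of a window, so a constant sequence
      exhausts it within the generator.\<close>
    have "?\<Omega> = restrict_graph (L 0) -` space (sym_counting_space (L 0)) \<inter> ?\<Omega>"
      using restrict_graph_eq_config(3)[OF _ open_L subset_UNIV] by auto
    then show "range (\<lambda>_::nat. ?\<Omega>) \<subseteq> ?E" by blast
    show "(\<Union>_::nat. ?\<Omega>) = ?\<Omega>" by simp
    show "emeasure \<nu> ?\<Omega> \<noteq> \<infinity>" by simp
  qed blast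
qed

definition consistent :: "(nat \<Rightarrow> ('a \<times> 'a) measure) \<Rightarrow> bool" where
  "consistent \<zeta> \<longleftrightarrow> (\<forall>n. \<zeta> n \<in> sym_counting_measures (L n)) \<and>
     (\<forall>n m. n \<le> m \<longrightarrow> \<zeta> n = restrict_graph (L n) (\<zeta> m))"

lemma consistent_atoms_mono:
  assumes "consistent \<zeta>" "n \<le> m"
  shows "atoms (\<zeta> n) = atoms (\<zeta> m) \<inter> L n \<times> L n"
proof -
  have "\<zeta> m \<in> sym_counting_measures (L m)" "\<zeta> n = restrict_graph (L n) (\<zeta> m)"
    using assms unfolding consistent_def by blast+
  then show ?thesis
    using restrict_graph_eq_config(4)[OF _ open_L L_mono[OF assms(2)]] by simp
qed

lemma consistent_edge_set:
  "consistent \<zeta> \<Longrightarrow> edge_set (L n) (atoms (\<zeta> n))"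
  unfolding consistent_def using sym_counting_measures_eq_config(2) by blast

text \<open>Gluing adds nothing inside a window already filled: an atom from level \<open>m\<close>
  is compared with level \<open>n\<close> at their maximum.\<close>

lemma consistent_UN_atoms:
  assumes "consistent \<zeta>"
  shows "(\<Union>m. atoms (\<zeta> m)) \<inter> L n \<times> L n = atoms (\<zeta> n)"
proof (intro equalityI subsetI)
  fix x assume "x \<in> (\<Union>m. atoms (\<zeta> m)) \<inter> L n \<times> L n"
  then obtain m where m: "x \<in> atoms (\<zeta> m)" and x: "x \<in> L n \<times> L n" by blast
  have "x \<in> atoms (\<zeta> (max n m))"
    using m consistent_atoms_mono[OF assms, of m "max n m"] by simp
  with x show "x \<in> atoms (\<zeta> n)"
    using consistent_atoms_mono[OF assms, of n "max n m"] by simp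
next
  fix x assume "x \<in> atoms (\<zeta> n)"
  moreover have "atoms (\<zeta> n) \<subseteq> L n \<times> L n"
    using consistent_edge_set[OF assms] by (simp add: edge_set_def)
  ultimately show "x \<in> (\<Union>m. atoms (\<zeta> m)) \<inter> L n \<times> L n" by blast
qed

text \<open>Near a point of the open window \<open>L n \<times> L n\<close> the union has only the
  atoms of \<open>\<zeta> n\<close>, so local finiteness is inherited.\<close>

lemma edge_set_UN_atoms:
  assumes "consistent \<zeta>"
  shows "edge_set UNIV (\<Union>n. atoms (\<zeta> n))"
proof -
  have "prod.swap ` atoms (\<zeta> n) = atoms (\<zeta> n)" for n
    using consistent_edge_set[OF assms, of n] by (simp add: edge_set_def)
  then have "prod.swap ` (\<Union>n. atoms (\<zeta> n)) = (\<Union>n. atoms (\<zeta> n))"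
    by (simp only: image_UN)
  moreover have "\<exists>U. open U \<and> x \<in> U \<and> finite (U \<inter> (\<Union>n. atoms (\<zeta> n)))" for x
  proof -
    have "x \<in> (\<Union>n. L n \<times> L n)" unfolding UN_L_Times by (rule UNIV_I)
    then obtain n where n: "x \<in> L n \<times> L n" by (elim UN_E)
    then obtain U where U: "open U" "x \<in> U" "finite (U \<inter> atoms (\<zeta> n))"
      using consistent_edge_set[OF assms, of n] unfolding edge_set_def by blast
    have "(U \<inter> L n \<times> L n) \<inter> (\<Union>n. atoms (\<zeta> n)) = U \<inter> ((\<Union>n. atoms (\<zeta> n)) \<inter> L n \<times> L n)"
      by (simp only: Int_ac)
    with U(3) have "finite ((U \<inter> L n \<times> L n) \<inter> (\<Union>n. atoms (\<zeta> n)))"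
      by (simp only: consistent_UN_atoms[OF assms])
    moreover have "open (U \<inter> L n \<times> L n)" using U(1) open_L by (intro open_Int open_Times)
    ultimately show ?thesis using U(2) n by blast
  qed
  ultimately show ?thesis by (simp add: edge_set_def)
qed

lemma restrict_graph_glue:
  assumes "consistent \<zeta>"
  shows "restrict_graph (L n) (config UNIV (\<Union>m. atoms (\<zeta> m))) = \<zeta> n"
proof -
  have "\<zeta> n \<in> sym_counting_measures (L n)" using assms by (simp add: consistent_def)
  from sym_counting_measures_eq_config(1)[OF this] show ?thesis
    using restrict_graph_config[OF open_L subset_UNIV, of "\<Union>m. atoms (\<zeta> m)" n]
    by (simp add: consistent_UN_atoms[OF assms])
qed

text \<open>On \<open>G\<close> the atoms increase with \<open>n\<close>, so their number in a Borel
  set is a supremum of measurable functions; elsewhere the empty graph is used.\<close>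

lemma measurable_glue:
  assumes G: "G \<in> sets N" and cons: "\<And>x. x \<in> G \<Longrightarrow> consistent (\<zeta> x)"
    and meas: "\<And>n. (\<lambda>x. \<zeta> x n) \<in> measurable N (sym_counting_space (L n))"
  shows "(\<lambda>x. config UNIV (if x \<in> G then (\<Union>n. atoms (\<zeta> x n)) else {}))
    \<in> measurable N (sym_counting_space UNIV)"
proof (rule measurable_config[OF open_UNIV])
  show "edge_set UNIV (if x \<in> G then (\<Union>n. atoms (\<zeta> x n)) else {})" for x
    using edge_set_UN_atoms cons by (simp add: edge_set_empty)
  fix A :: "('a \<times> 'a) set" assume A: "A \<in> sets borel"
  have count: "emeasure (count_space UNIV) (A \<inter> (\<Union>n. atoms (\<zeta> x n))) =
      (SUP n. emeasure (\<zeta> x n) (A \<inter> L n \<times> L n))" if x: "x \<in> G" for x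
  proof -
    have "incseq (\<lambda>n. A \<inter> atoms (\<zeta> x n))"
      unfolding incseq_def using consistent_atoms_mono[OF cons[OF x]] by blast
    then have "(SUP n. emeasure (count_space UNIV) (A \<inter> atoms (\<zeta> x n))) =
        emeasure (count_space UNIV) (\<Union>n. A \<inter> atoms (\<zeta> x n))"
      by (intro SUP_emeasure_incseq) simp_all
    moreover have "emeasure (\<zeta> x n) (A \<inter> L n \<times> L n) = emeasure (count_space UNIV) (A \<inter> atoms (\<zeta> x n))" for n
    proof -
      have "\<zeta> x n \<in> sym_counting_measures (L n)" using cons[OF x] by (simp add: consistent_def)
      from emeasure_sym_counting_measures[OF this Int_in_restrict_borel[OF A]]
      have "emeasure (\<zeta> x n) (A \<inter> L n \<times> L n) = emeasure (count_space UNIV) (A \<inter> L n \<times> L n \<inter> atoms (\<zeta> x n))" .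
      moreover have "A \<inter> L n \<times> L n \<inter> atoms (\<zeta> x n) = A \<inter> atoms (\<zeta> x n)"
        using consistent_edge_set[OF cons[OF x], of n] unfolding edge_set_def by blast
      ultimately show ?thesis by simp
    qed
    ultimately show ?thesis by (simp only: Int_UN_distrib)
  qed
  have "(\<lambda>x. if x \<in> G then SUP n. emeasure (\<zeta> x n) (A \<inter> L n \<times> L n) else 0) \<in> borel_measurable N"
    using G measurable_compose[OF meas measurable_emeasure_sym_counting_space[OF Int_in_restrict_borel[OF A]]]
    by (intro measurable_If_set borel_measurable_SUP) simp_all
  then show "(\<lambda>x. emeasure (count_space UNIV) (A \<inter> (if x \<in> G then (\<Union>n. atoms (\<zeta> x n)) else {})))
      \<in> borel_measurable N"
    by (rule measurable_cong[THEN iffD1, rotated]) (simp add: count)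
qed

end

section \<open>Existence of the projective limit\<close>

locale projective_graphs = graph_exhaustion L for L :: "nat \<Rightarrow> 'a::euclidean_space set" +
  fixes \<mu> :: "nat \<Rightarrow> ('a \<times> 'a) measure measure"
  assumes random_graph_\<mu>: "random_graph (L n) (\<mu> n)"
    and projective: "n \<le> m \<Longrightarrow> \<mu> n = distr (\<mu> m) (sym_counting_space (L n)) (restrict_graph (L n))"
begin

lemma sets_\<mu> [measurable_cong]: "sets (\<mu> n) = sets (sym_counting_space (L n))"
  using random_graph_\<mu> by (simp add: random_graph_def)

lemma space_\<mu>: "space (\<mu> n) = sym_counting_measures (L n)"
  using sets_eq_imp_space_eq[OF sets_\<mu>] by simp

lemma prob_space_\<mu>: "prob_space (\<mu> n)"
  using random_graph_\<mu> by (simp add: random_graph_def)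

text \<open>Restricting first makes one function applicable to graphs on every \<open>L m\<close>
  with \<open>n \<le> m\<close>, so codes of several levels can be read off a single graph.\<close>

definition encode :: "nat \<Rightarrow> ('a \<times> 'a) measure \<Rightarrow> nat \<Rightarrow> real \<times> 'a \<times> 'a" where
  "encode n \<xi> = edge_code (L n) (restrict_graph (L n) \<xi>)"

lemma measurable_restrict_\<mu>:
  "n \<le> m \<Longrightarrow> restrict_graph (L n) \<in> measurable (\<mu> m) (sym_counting_space (L n))"
  using measurable_restrict_graph[OF open_L L_mono] by (simp cong: measurable_cong_sets add: sets_\<mu>)

lemma measurable_encode_sym_counting_space:
  "n \<le> m \<Longrightarrow> encode n \<in> borel_measurable (sym_counting_space (L m))"
  unfolding encode_def
  using measurable_compose[OF measurable_restrict_graph[OF open_L L_mono] measurable_edge_code] .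

lemma measurable_encode: "n \<le> m \<Longrightarrow> encode n \<in> borel_measurable (\<mu> m)"
  using measurable_encode_sym_counting_space by (simp only: measurable_cong_sets[OF sets_\<mu> refl])

lemma encode_restrict_graph:
  assumes "\<xi> \<in> sym_counting_measures (L k)" "n \<le> m" "m \<le> k"
  shows "encode n (restrict_graph (L m) \<xi>) = encode n \<xi>"
  unfolding encode_def restrict_graph_restrict_graph[OF assms(1) open_L open_L L_mono[OF assms(2)] L_mono[OF assms(3)]] ..

lemma decode_encode:
  assumes "\<xi> \<in> sym_counting_measures (L m)" "n \<le> m"
  shows "decode (L n) (encode n \<xi>) = restrict_graph (L n) \<xi>"
  unfolding encode_def
  by (rule decode_edge_code[OF restrict_graph_eq_config(3)[OF assms(1) open_L L_mono[OF assms(2)]]])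

text \<open>The joint law of the codes at the levels in \<open>J\<close>, read off one graph at the
  highest of them; the inserted 0 settles the empty \<open>J\<close>.\<close>

definition marginal :: "nat set \<Rightarrow> (nat \<Rightarrow> nat \<Rightarrow> real \<times> 'a \<times> 'a) measure" where
  "marginal J = distr (\<mu> (Max (insert 0 J))) (PiM J (\<lambda>_. borel)) (\<lambda>\<xi>. \<lambda>n\<in>J. encode n \<xi>)"

lemma measurable_encode_PiM:
  assumes "J \<subseteq> {..m}"
  shows "(\<lambda>\<xi>. \<lambda>n\<in>J. encode n \<xi>) \<in> measurable (\<mu> m) (PiM J (\<lambda>_. borel))"
  using assms by (intro measurable_restrict measurable_encode) auto

text \<open>Projectivity turns the law at level \<open>m\<close> into that at the highest level of
  \<open>J\<close>, and the codes do not notice the intermediate restriction.\<close>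

lemma marginal_eq:
  assumes J: "J \<subseteq> {..m}"
  shows "marginal J = distr (\<mu> m) (PiM J (\<lambda>_. borel)) (\<lambda>\<xi>. \<lambda>n\<in>J. encode n \<xi>)"
proof -
  define k where "k = Max (insert 0 J)"
  have km: "k \<le> m" and Jk: "J \<subseteq> {..k}"
    using J finite_subset[OF J] by (auto simp: k_def)
  have "marginal J = distr (distr (\<mu> m) (sym_counting_space (L k)) (restrict_graph (L k)))
      (PiM J (\<lambda>_. borel)) (\<lambda>\<xi>. \<lambda>n\<in>J. encode n \<xi>)"
    unfolding marginal_def k_def[symmetric] projective[OF km, symmetric] ..
  also have "\<dots> = distr (\<mu> m) (PiM J (\<lambda>_. borel)) ((\<lambda>\<xi>. \<lambda>n\<in>J. encode n \<xi>) \<circ> restrict_graph (L k))"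
    using measurable_encode_PiM[OF Jk] measurable_restrict_\<mu>[OF km]
    by (intro distr_distr) (simp_all cong: measurable_cong_sets add: sets_\<mu>)
  also have "\<dots> = distr (\<mu> m) (PiM J (\<lambda>_. borel)) (\<lambda>\<xi>. \<lambda>n\<in>J. encode n \<xi>)"
  proof (rule distr_cong)
    fix \<xi> assume "\<xi> \<in> space (\<mu> m)"
    then show "((\<lambda>\<xi>. \<lambda>n\<in>J. encode n \<xi>) \<circ> restrict_graph (L k)) \<xi> = (\<lambda>n\<in>J. encode n \<xi>)"
      using encode_restrict_graph[OF _ _ km] Jk by (auto simp: space_\<mu> intro!: restrict_ext)
  qed simp_all
  finally show ?thesis .
qed

text \<open>Read at a common level, the two families of codes are functions of the same graph, one
  being a subfamily of the other.\<close>

lemma polish_projective_marginal: "polish_projective UNIV marginal"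
proof (intro polish_projective.intro projective_family.intro)
  fix J H :: "nat set" assume JH: "J \<subseteq> H" and H: "finite H"
  define m where "m = Max (insert 0 H)"
  have Hm: "H \<subseteq> {..m}" using H by (auto simp: m_def)
  have Jm: "J \<subseteq> {..m}" using Hm JH by blast
  have "distr (marginal H) (PiM J (\<lambda>_. borel)) (\<lambda>f. restrict f J) =
      distr (\<mu> m) (PiM J (\<lambda>_. borel)) ((\<lambda>f. restrict f J) \<circ> (\<lambda>\<xi>. \<lambda>n\<in>H. encode n \<xi>))"
    unfolding marginal_eq[OF Hm]
    using measurable_encode_PiM[OF Hm] JH by (intro distr_distr measurable_restrict_subset) simp_all
  also have "(\<lambda>f. restrict f J) \<circ> (\<lambda>\<xi>. \<lambda>n\<in>H. encode n \<xi>) = (\<lambda>\<xi>. \<lambda>n\<in>J. encode n \<xi>)"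
    using JH by (auto simp: fun_eq_iff restrict_def)
  finally show "marginal J = distr (marginal H) (PiM J (\<lambda>_. borel)) (\<lambda>f. restrict f J)"
    unfolding marginal_eq[OF Jm] by (rule sym)
next
  fix J :: "nat set" assume J: "finite J"
  show "prob_space (marginal J)"
    unfolding marginal_def using J
    by (intro prob_space.prob_space_distr prob_space_\<mu> measurable_encode_PiM) auto
qed

sublocale kolmogorov: polish_projective UNIV marginal
  by (rule polish_projective_marginal)

lemma distr_lim_restrict:
  assumes "finite J"
  shows "distr kolmogorov.lim (PiM J (\<lambda>_. borel)) (\<lambda>f. restrict f J) = marginal J"
proof (rule measure_eqI)
  fix X assume "X \<in> sets (distr kolmogorov.lim (PiM J (\<lambda>_. borel)) (\<lambda>f. restrict f J))"
  then have X: "X \<in> sets (PiM J (\<lambda>_. borel))" by simp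
  have "(\<lambda>f. restrict f J) \<in> measurable kolmogorov.lim (PiM J (\<lambda>_. borel))"
    by (subst measurable_cong_sets[OF kolmogorov.sets_lim refl]) (intro measurable_restrict_subset subset_UNIV)
  then have "emeasure (distr kolmogorov.lim (PiM J (\<lambda>_. borel)) (\<lambda>f. restrict f J)) X =
      emeasure kolmogorov.lim (prod_emb UNIV (\<lambda>_. borel) J X)"
    using X by (simp add: emeasure_distr prod_emb_def space_PiM)
  also have "\<dots> = emeasure (marginal J) X"
    using kolmogorov.emeasure_lim_emb[OF subset_UNIV assms X] .
  finally show "emeasure (distr kolmogorov.lim (PiM J (\<lambda>_. borel)) (\<lambda>f. restrict f J)) X =
      emeasure (marginal J) X" .
qed (simp add: marginal_def)

abbreviation codes :: "(nat \<Rightarrow> nat \<Rightarrow> real \<times> 'a \<times> 'a) measure" where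
  "codes \<equiv> kolmogorov.lim"

text \<open>The condition compares codes instead of graphs, as an equation between Borel maps into a
  Polish space is an event. The case \<open>n = m\<close> says that \<open>w m\<close> is the code
  of the graph it decodes to.\<close>

definition coherent :: "(nat \<Rightarrow> nat \<Rightarrow> real \<times> 'a \<times> 'a) set" where
  "coherent = {w. \<forall>n m. n \<le> m \<longrightarrow> w n = encode n (decode (L m) (w m))}"

lemma measurable_code: "(\<lambda>w. w n) \<in> borel_measurable codes"
  by (subst measurable_cong_sets[OF kolmogorov.sets_lim refl]) (rule measurable_component_singleton, simp)

lemma measurable_encode_decode:
  assumes "n \<le> m"
  shows "(\<lambda>z. encode n (decode (L m) z)) \<in> borel_measurable borel"
  using measurable_compose[OF measurable_decode[OF open_L] measurable_encode_sym_counting_space[OF assms]] .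

lemma sets_coherent: "coherent \<in> sets codes"
proof -
  have "coherent = (\<Inter>n. \<Inter>m\<in>{n..}. {w \<in> space codes. w n = encode n (decode (L m) (w m))})"
    by (auto simp: coherent_def space_PiM)
  also have "\<dots> \<in> sets codes"
  proof (intro sets.countable_INT'')
    show "UNIV \<in> sets codes" "UNIV \<in> sets codes"
      using sets.top[of codes] by (simp_all add: space_PiM)
    show "{w \<in> space codes. w n = encode n (decode (L m) (w m))} \<in> sets codes" if "m \<in> {n..}" for n m
      using that
      by (intro sets_Collect_eq_borel measurable_code
          measurable_compose[OF measurable_code measurable_encode_decode]) simp
  qed simp_all
  finally show ?thesis .
qed

text \<open>Each equation involves two coordinates, whose joint law is that of the codes at levels
  \<open>n\<close> and \<open>m\<close> of one random graph on \<open>L m\<close>. There it holds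
  for every graph, because decoding inverts encoding, and there are countably many pairs.\<close>

lemma AE_coherent: "AE w in codes. w \<in> coherent"
proof -
  have "AE w in codes. w n = encode n (decode (L m) (w m))" if nm: "n \<le> m" for n m
  proof -
    have J: "{n, m} \<subseteq> {..m}" using nm by simp
    let ?P = "\<lambda>w. w n = encode n (decode (L m) (w m))"
    have c: "(\<lambda>w. w i) \<in> borel_measurable (PiM {n, m} (\<lambda>_. borel))" if "i \<in> {n, m}" for i
      using that by (rule measurable_component_singleton)
    have S: "{w \<in> space (PiM {n, m} (\<lambda>_. borel)). ?P w} \<in> sets (PiM {n, m} (\<lambda>_. borel))"
      by (intro sets_Collect_eq_borel c measurable_compose[OF c measurable_encode_decode[OF nm]]) simp_all
    have "AE \<xi> in \<mu> m. encode n \<xi> = encode n (decode (L m) (encode m \<xi>))"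
    proof (rule AE_I2)
      fix \<xi> assume "\<xi> \<in> space (\<mu> m)"
      then have \<xi>: "\<xi> \<in> sym_counting_measures (L m)" by (simp add: space_\<mu>)
      show "encode n \<xi> = encode n (decode (L m) (encode m \<xi>))"
        unfolding decode_encode[OF \<xi> order_refl] restrict_graph_self[OF \<xi> open_L] ..
    qed
    then have "AE w in marginal {n, m}. ?P w"
      unfolding marginal_eq[OF J] by (subst AE_distr_iff[OF measurable_encode_PiM[OF J] S]) simp
    then have "AE w in codes. ?P (restrict w {n, m})"
      unfolding distr_lim_restrict[of "{n, m}", simplified, symmetric]
      by (subst (asm) AE_distr_iff[OF _ S])
        (subst measurable_cong_sets[OF kolmogorov.sets_lim refl], intro measurable_restrict_subset subset_UNIV)
    then show ?thesis by simp
  qed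
  then have "AE w in codes. \<forall>n m. n \<le> m \<longrightarrow> w n = encode n (decode (L m) (w m))"
    by (simp add: AE_all_countable)
  then show ?thesis by (simp add: coherent_def)
qed

lemma decode_in: "decode (L n) z \<in> sym_counting_measures (L n)"
  using measurable_space[OF measurable_decode[OF open_L]] by simp

lemma consistent_decode:
  assumes "w \<in> coherent"
  shows "consistent (\<lambda>n. decode (L n) (w n))"
  unfolding consistent_def
proof (intro conjI allI impI decode_in)
  fix n m :: nat assume nm: "n \<le> m"
  then have "w n = encode n (decode (L m) (w m))" using assms by (simp add: coherent_def)
  then show "decode (L n) (w n) = restrict_graph (L n) (decode (L m) (w m))"
    using decode_encode[OF decode_in nm] by simp
qed

text \<open>A single coordinate has the law of the code of a graph drawn from
  \<open>\<mu> n\<close>, and decoding undoes the coding.\<close>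

lemma distr_decode: "distr codes (sym_counting_space (L n)) (\<lambda>w. decode (L n) (w n)) = \<mu> n"
proof -
  have c: "(\<lambda>w. w n) \<in> borel_measurable (PiM {n} (\<lambda>_. borel))"
    by (rule measurable_component_singleton) simp
  have d: "(\<lambda>w. decode (L n) (w n)) \<in> measurable (PiM {n} (\<lambda>_. borel)) (sym_counting_space (L n))"
    using measurable_compose[OF c measurable_decode[OF open_L]] .
  have r: "(\<lambda>f. restrict f {n}) \<in> measurable codes (PiM {n} (\<lambda>_. borel))"
    by (subst measurable_cong_sets[OF kolmogorov.sets_lim refl]) (intro measurable_restrict_subset subset_UNIV)
  have J: "{n} \<subseteq> {..n}" by simp
  have "distr codes (sym_counting_space (L n)) (\<lambda>w. decode (L n) (w n)) =
      distr (distr codes (PiM {n} (\<lambda>_. borel)) (\<lambda>f. restrict f {n})) (sym_counting_space (L n)) (\<lambda>w. decode (L n) (w n))"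
    by (subst distr_distr[OF d r]) (simp add: comp_def)
  also have "\<dots> = distr (marginal {n}) (sym_counting_space (L n)) (\<lambda>w. decode (L n) (w n))"
    by (subst distr_lim_restrict) simp_all
  also have "\<dots> = distr (\<mu> n) (sym_counting_space (L n)) (\<lambda>\<xi>. decode (L n) (encode n \<xi>))"
    unfolding marginal_eq[OF J]
    by (subst distr_distr[OF d measurable_encode_PiM[OF J]]) (simp add: comp_def)
  also have "\<dots> = distr (\<mu> n) (\<mu> n) (\<lambda>\<xi>. \<xi>)"
    by (intro distr_cong) (simp_all add: sets_\<mu> space_\<mu> decode_encode restrict_graph_self open_L)
  finally show ?thesis by simp
qed

lemma ex_projective_limit:
  "\<exists>\<nu>. random_graph UNIV \<nu> \<and>
    (\<forall>n. distr \<nu> (sym_counting_space (L n)) (restrict_graph (L n)) = \<mu> n)"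
proof -
  define \<Phi> where "\<Phi> w = config UNIV (if w \<in> coherent then (\<Union>n. atoms (decode (L n) (w n))) else {})" for w
  define \<nu> where "\<nu> = distr codes (sym_counting_space UNIV) \<Phi>"
  have dm: "(\<lambda>w. decode (L n) (w n)) \<in> measurable codes (sym_counting_space (L n))" for n
    using measurable_compose[OF measurable_code measurable_decode[OF open_L]] .
  have \<Phi>: "\<Phi> \<in> measurable codes (sym_counting_space UNIV)"
    unfolding \<Phi>_def by (rule measurable_glue[OF sets_coherent consistent_decode dm])
  have "random_graph UNIV \<nu>"
    unfolding random_graph_def \<nu>_def using kolmogorov.P.prob_space_distr[OF \<Phi>] by simp
  moreover have "distr \<nu> (sym_counting_space (L n)) (restrict_graph (L n)) = \<mu> n" for n
  proof -
    note r = measurable_restrict_graph[OF open_L[of n] subset_UNIV]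
    have "distr \<nu> (sym_counting_space (L n)) (restrict_graph (L n)) =
        distr codes (sym_counting_space (L n)) (\<lambda>w. restrict_graph (L n) (\<Phi> w))"
      unfolding \<nu>_def by (subst distr_distr[OF r \<Phi>]) (simp add: comp_def)
    also have "\<dots> = distr codes (sym_counting_space (L n)) (\<lambda>w. decode (L n) (w n))"
    \<comment> \<open>Gluing returns the decoded graphs on \<open>coherent\<close> only, which has
      full measure.\<close>
    proof (rule distr_cong_AE)
      show "AE w in codes. restrict_graph (L n) (\<Phi> w) = decode (L n) (w n)"
        using AE_coherent by eventually_elim (simp add: \<Phi>_def restrict_graph_glue[OF consistent_decode])
    qed (use dm measurable_compose[OF \<Phi> r] in simp_all)
    finally show ?thesis by (simp only: distr_decode)
  qed
  ultimately show ?thesis by blast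
qed

end

section \<open>Rotations\<close>

lemma is_rotation_props:
  fixes \<phi> :: "real^'n \<Rightarrow> real^'n"
  assumes "is_rotation \<phi>"
  shows "linear \<phi>" "bij \<phi>" "norm (\<phi> x) = norm x"
proof -
  obtain Q where "rotation_matrix Q" and \<phi>: "\<phi> = (\<lambda>x. Q *v x)"
    using assms by (auto simp: is_rotation_def)
  then have "orthogonal_transformation \<phi>"
    by (simp add: rotation_matrix_def orthogonal_transformation_matrix matrix_vector_mul_linear)
  then show "linear \<phi>" "bij \<phi>" "norm (\<phi> x) = norm x"
    by (auto simp: orthogonal_transformation_linear orthogonal_transformation_norm
        orthogonal_transformation_bij)
qed

lemma rotation_image_ball:
  fixes \<phi> :: "real^'n \<Rightarrow> real^'n"
  assumes "is_rotation \<phi>"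
  shows "\<phi> ` ball 0 r = ball 0 r"
proof (intro equalityI subsetI)
  fix y :: "real^'n" assume y: "y \<in> ball 0 r"
  obtain x where "y = \<phi> x" using is_rotation_props(2)[OF assms] by (metis bij_pointE)
  with y show "y \<in> \<phi> ` ball 0 r" using is_rotation_props(3)[OF assms] by auto
qed (use is_rotation_props(3)[OF assms] in auto)

lemma linear_map_prod:
  assumes "linear f"
  shows "linear (map_prod f f)"
  by (rule linearI) (auto simp: linear_add[OF assms] linear_scale[OF assms] map_prod_def split_beta)

lemma borel_measurable_linear:
  fixes f :: "'b::euclidean_space \<Rightarrow> 'c::real_normed_vector"
  assumes "linear f"
  shows "f \<in> borel_measurable borel"
  using assms by (intro borel_measurable_continuous_onI linear_continuous_on linear_linear[THEN iffD2])

text \<open>The action moves the atoms by an injective linear map that preserves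
  \<open>L \<times> L\<close> and commutes with the swap.\<close>

lemma act_rotation:
  fixes \<phi> :: "real^'n \<Rightarrow> real^'n"
  assumes \<phi>: "is_rotation \<phi>" and L: "open L" "\<phi> ` L = L" and \<xi>: "\<xi> \<in> sym_counting_measures L"
  shows "act \<phi> \<xi> \<in> sym_counting_measures L"
    and "atoms (act \<phi> \<xi>) = map_prod \<phi> \<phi> ` atoms \<xi>"
proof -
  let ?f = "map_prod \<phi> \<phi>"
  have T: "edge_set L (atoms \<xi>)" and \<xi>_eq: "\<xi> = config L (atoms \<xi>)"
    using sym_counting_measures_eq_config[OF \<xi>] by blast+
  have sub: "atoms \<xi> \<subseteq> L \<times> L" using T by (simp add: edge_set_def)
  note bij = is_rotation_props(2)[OF \<phi>]
  have f_L: "?f ` (L \<times> L) = L \<times> L"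
    using L(2) by (simp add: map_prod_surj_on)
  have inj_f: "inj ?f" using bij by (simp add: prod.inj_map bij_is_inj)
  have surj_f: "surj ?f" using bij by (simp add: map_prod_surj bij_is_surj)
  note lin_f = linear_map_prod[OF is_rotation_props(1)[OF \<phi>]]
  note meas_f = borel_measurable_linear[OF lin_f]
  have f_sub: "?f ` atoms \<xi> \<subseteq> L \<times> L" using sub f_L by blast
  have "distr (config L (atoms \<xi>)) (config L (atoms \<xi>)) ?f = config L (?f ` atoms \<xi>)"
    by (rule distr_config[OF sub meas_f inj_f]) (simp add: f_L)
  then have act_eq: "act \<phi> \<xi> = config L (?f ` atoms \<xi>)"
    unfolding act_def using \<xi>_eq by simp
  have "prod.swap ` ?f ` atoms \<xi> = ?f ` prod.swap ` atoms \<xi>"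
    unfolding image_image by (intro image_cong refl) (simp add: map_prod_def prod.swap_def split_beta)
  also have "prod.swap ` atoms \<xi> = atoms \<xi>" using T by (simp add: edge_set_def)
  finally have swap: "prod.swap ` ?f ` atoms \<xi> = ?f ` atoms \<xi>" .
  have fin: "\<exists>U. open U \<and> x \<in> U \<and> finite (U \<inter> ?f ` atoms \<xi>)" if x: "x \<in> L \<times> L" for x
  proof -
    have "x \<in> ?f ` (L \<times> L)" using x by (simp only: f_L)
    then obtain y where y: "y \<in> L \<times> L" "x = ?f y" by (elim imageE)
    have "\<exists>U. open U \<and> y \<in> U \<and> finite (U \<inter> atoms \<xi>)"
      using T y(1) unfolding edge_set_def by blast
    then obtain U where U: "open U" "y \<in> U" "finite (U \<inter> atoms \<xi>)" by (elim exE conjE)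
    \<comment> \<open>Local finiteness at \<open>x\<close> is carried over from its preimage
      \<open>y\<close>, as a surjective linear map is open.\<close>
    have "open (?f ` U)" using open_surjective_linear_image[OF U(1) lin_f surj_f] .
    moreover have "?f ` U \<inter> ?f ` atoms \<xi> = ?f ` (U \<inter> atoms \<xi>)"
      using image_Int[OF inj_f] by simp
    ultimately show ?thesis using U(2,3) y(2) by (intro exI[of _ "?f ` U"]) simp
  qed
  have "edge_set L (?f ` atoms \<xi>)"
    unfolding edge_set_def using f_sub swap fin by simp
  from config_in_sym_counting_measures[OF L(1) this]
  show "act \<phi> \<xi> \<in> sym_counting_measures L" by (simp only: act_eq)
  show "atoms (act \<phi> \<xi>) = ?f ` atoms \<xi>" unfolding act_eq by (rule atoms_config[OF f_sub])
qed

lemma emeasure_act_rotation: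
  fixes \<phi> :: "real^'n \<Rightarrow> real^'n"
  assumes \<phi>: "is_rotation \<phi>" and L: "\<phi> ` L = L" and \<xi>: "\<xi> \<in> sym_counting_measures L"
    and A: "A \<in> sets (restrict_space borel (L \<times> L))"
  shows "emeasure (act \<phi> \<xi>) A = emeasure \<xi> (map_prod \<phi> \<phi> -` A \<inter> L \<times> L)"
    and "map_prod \<phi> \<phi> -` A \<inter> L \<times> L \<in> sets (restrict_space borel (L \<times> L))"
proof -
  note meas_f = borel_measurable_linear[OF linear_map_prod[OF is_rotation_props(1)[OF \<phi>]]]
  have "map_prod \<phi> \<phi> \<in> measurable (restrict_space borel (L \<times> L)) (restrict_space borel (L \<times> L))"
    using L by (intro measurable_restrict_space3 meas_f) (auto simp: Pi_iff)
  then have m: "map_prod \<phi> \<phi> \<in> measurable \<xi> \<xi>"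
    by (simp only: measurable_cong_sets[OF sym_counting_measuresD(1)[OF \<xi>] sym_counting_measuresD(1)[OF \<xi>]])
  have A': "A \<in> sets \<xi>" using A sym_counting_measuresD(1)[OF \<xi>] by simp
  show "emeasure (act \<phi> \<xi>) A = emeasure \<xi> (map_prod \<phi> \<phi> -` A \<inter> L \<times> L)"
    unfolding act_def using emeasure_distr[OF m A'] sym_counting_measuresD(2)[OF \<xi>] by simp
  show "map_prod \<phi> \<phi> -` A \<inter> L \<times> L \<in> sets (restrict_space borel (L \<times> L))"
    using measurable_sets[OF m A'] sym_counting_measuresD(1,2)[OF \<xi>] by simp
qed

lemma measurable_act_rotation:
  fixes \<phi> :: "real^'n \<Rightarrow> real^'n"
  assumes \<phi>: "is_rotation \<phi>" and L: "open L" "\<phi> ` L = L"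
  shows "act \<phi> \<in> measurable (sym_counting_space L) (sym_counting_space L)"
proof (rule measurable_sym_counting_spaceI)
  show "act \<phi> \<xi> \<in> sym_counting_measures L" if "\<xi> \<in> space (sym_counting_space L)" for \<xi>
    using act_rotation(1)[OF \<phi> L] that by simp
  fix A assume A: "A \<in> sets (restrict_space borel (L \<times> L))"
  show "(\<lambda>\<xi>. emeasure (act \<phi> \<xi>) A) \<in> borel_measurable (sym_counting_space L)"
  \<comment> \<open>Measurability of the rotated preimage of \<open>A\<close> was derived through a
    graph on \<open>L\<close>, so one has to be at hand.\<close>
  proof (cases "sym_counting_measures L = {}")
    case True
    then show ?thesis by (intro measurableI) simp_all
  next
    case False
    then obtain \<xi>\<^sub>0 where "\<xi>\<^sub>0 \<in> sym_counting_measures L" by blast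
    from measurable_emeasure_sym_counting_space[OF emeasure_act_rotation(2)[OF \<phi> L(2) this A]]
    show ?thesis
      by (rule measurable_cong[THEN iffD1, rotated]) (simp add: emeasure_act_rotation(1)[OF \<phi> L(2) _ A])
  qed
qed

text \<open>On atoms this says that an injective map preserving \<open>K \<times> K\<close> commutes
  with intersecting by it.\<close>

lemma restrict_graph_act_rotation:
  fixes \<phi> :: "real^'n \<Rightarrow> real^'n"
  assumes \<phi>: "is_rotation \<phi>" and K: "open K" "\<phi> ` K = K" and L: "open L" "\<phi> ` L = L"
    and KL: "K \<subseteq> L" and \<xi>: "\<xi> \<in> sym_counting_measures L"
  shows "restrict_graph K (act \<phi> \<xi>) = act \<phi> (restrict_graph K \<xi>)"
proof (rule sym_counting_measures_eqI)
  note act = act_rotation[OF \<phi> L \<xi>]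
  note r = restrict_graph_eq_config(3,4)[OF \<xi> K(1) KL]
  note ra = restrict_graph_eq_config(3,4)[OF act(1) K(1) KL]
  note ar = act_rotation[OF \<phi> K r(1)]
  show "restrict_graph K (act \<phi> \<xi>) \<in> sym_counting_measures K" by (rule ra(1))
  show "act \<phi> (restrict_graph K \<xi>) \<in> sym_counting_measures K" by (rule ar(1))
  have "inj (map_prod \<phi> \<phi>)" using is_rotation_props(2)[OF \<phi>] by (simp add: prod.inj_map bij_is_inj)
  moreover have "map_prod \<phi> \<phi> ` (K \<times> K) = K \<times> K" using K(2) by (simp add: map_prod_surj_on)
  ultimately show "atoms (restrict_graph K (act \<phi> \<xi>)) = atoms (act \<phi> (restrict_graph K \<xi>))"
    unfolding ra(2) ar(2) act(2) r(2) by (simp add: image_Int)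
qed

text \<open>Invariance becomes a fixed-point equation between measures, the form to which uniqueness
  of the limit applies.\<close>

lemma rotation_invariant_iff_distr:
  fixes \<mu> :: "((real^'n) \<times> (real^'n)) measure measure"
  assumes "random_graph L \<mu>" "open L" and L: "\<And>\<phi>. is_rotation \<phi> \<Longrightarrow> \<phi> ` L = L"
  shows "rotation_invariant \<mu> \<longleftrightarrow> (\<forall>\<phi>. is_rotation \<phi> \<longrightarrow> distr \<mu> (sym_counting_space L) (act \<phi>) = \<mu>)"
proof -
  have sets: "sets \<mu> = sets (sym_counting_space L)" using assms(1) by (simp add: random_graph_def)
  have "(\<forall>A\<in>sets \<mu>. emeasure \<mu> A = emeasure \<mu> (act \<phi> -` A \<inter> space \<mu>)) \<longleftrightarrow>
      distr \<mu> (sym_counting_space L) (act \<phi>) = \<mu>" if \<phi>: "is_rotation \<phi>" for \<phi>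
  proof -
    have "act \<phi> \<in> measurable \<mu> (sym_counting_space L)"
      using measurable_act_rotation[OF \<phi> assms(2) L[OF \<phi>]]
      by (simp only: measurable_cong_sets[OF sets refl])
    then have "emeasure (distr \<mu> (sym_counting_space L) (act \<phi>)) A = emeasure \<mu> (act \<phi> -` A \<inter> space \<mu>)"
      if "A \<in> sets \<mu>" for A
      using that by (intro emeasure_distr) (simp_all add: sets)
    then show ?thesis
      by (auto intro!: measure_eqI simp: sets)
  qed
  then show ?thesis unfolding rotation_invariant_def by blast
qed

section \<open>The balls of integer volume as an exhaustion\<close>

lemma ball_0_subset_linear: "ball (0::'a::real_normed_vector) r \<subseteq> ball 0 s \<or> ball (0::'a) s \<subseteq> ball 0 r"
  using subset_ball[of r s] subset_ball[of s r] by (meson linear)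

text \<open>No radius is computed: concentric balls are nested, and the reverse inclusion would
  force the volumes, hence the balls, to coincide.\<close>

lemma vol_ball_mono:
  assumes "n \<le> m"
  shows "(vol_ball n :: 'a::euclidean_space set) \<subseteq> vol_ball m"
proof (rule ccontr)
  assume not_sub: "\<not> (vol_ball n :: 'a set) \<subseteq> vol_ball m"
  obtain r where r: "(vol_ball n :: 'a set) = ball 0 r" "emeasure lborel (vol_ball n :: 'a set) = of_nat n"
    by (rule vol_ball_spec)
  obtain s where s: "(vol_ball m :: 'a set) = ball 0 s" "emeasure lborel (vol_ball m :: 'a set) = of_nat m"
    by (rule vol_ball_spec)
  have "(vol_ball m :: 'a set) \<subseteq> vol_ball n"
    using not_sub ball_0_subset_linear unfolding r(1) s(1) by blast
  then have "emeasure lborel (vol_ball m :: 'a set) \<le> emeasure lborel (vol_ball n :: 'a set)"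
    by (rule emeasure_mono) (simp add: r(1))
  then have "m \<le> n" unfolding r(2) s(2) by simp
  with assms not_sub show False by simp
qed

lemma UN_vol_ball: "(\<Union>n. vol_ball (Suc n) :: 'a::euclidean_space set) = UNIV"
proof (intro equalityI subsetI)
  fix x :: 'a
  \<comment> \<open>The added 1 puts \<open>x\<close> inside the open ball; a concentric ball of
    larger volume must then contain \<open>x\<close>.\<close>
  have "emeasure lborel (ball (0::'a) (norm x + 1)) < \<infinity>"
    by (rule emeasure_bounded_finite) simp
  then obtain n where n: "emeasure lborel (ball (0::'a) (norm x + 1)) < of_nat n"
    using ennreal_Ex_less_of_nat by auto
  obtain s where s: "(vol_ball n :: 'a set) = ball 0 s" "emeasure lborel (vol_ball n :: 'a set) = of_nat n"
    by (rule vol_ball_spec)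
  have "\<not> (vol_ball n :: 'a set) \<subseteq> ball 0 (norm x + 1)"
  proof
    assume "(vol_ball n :: 'a set) \<subseteq> ball 0 (norm x + 1)"
    from emeasure_mono[OF this, of lborel] n show False by (simp add: s(2))
  qed
  then have "ball 0 (norm x + 1) \<subseteq> (vol_ball n :: 'a set)"
    using ball_0_subset_linear unfolding s(1) by blast
  then have "x \<in> vol_ball n" by (rule subsetD) simp
  \<comment> \<open>The union runs over positive volumes, so the index is moved up by one.\<close>
  then have "x \<in> vol_ball (Suc n)" using vol_ball_mono[OF le_SucI[OF order_refl]] by (rule rev_subsetD)
  then show "x \<in> (\<Union>n. vol_ball (Suc n))" by blast
qed simp

lemma graph_exhaustion_vol_ball:
  "graph_exhaustion (\<lambda>n. vol_ball (Suc n) :: 'a::euclidean_space set)"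
proof
  show "open (vol_ball (Suc n) :: 'a set)" for n
    using vol_ball_spec[of "Suc n", where 'a = 'a] by (metis open_ball)
  show "incseq (\<lambda>n. vol_ball (Suc n) :: 'a set)"
    unfolding incseq_def by (intro allI impI vol_ball_mono) simp
qed (rule UN_vol_ball)

lemma rotation_image_vol_ball:
  "is_rotation \<phi> \<Longrightarrow> \<phi> ` vol_ball n = (vol_ball n :: (real^'n) set)"
  using vol_ball_spec[of n, where 'a = "real^'n"] rotation_image_ball by metis

lemma all_ge_1_iff_all_Suc: "(\<forall>n\<ge>1::nat. P n) \<longleftrightarrow> (\<forall>n. P (Suc n))"
  by (metis One_nat_def Suc_le_D Suc_le_mono le0)

theorem mainTheorem6:
  fixes \<mu> :: "nat \<Rightarrow> ((real^'n) \<times> (real^'n)) measure measure"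
  assumes "CARD('n) \<ge> 2"
    and "projective_system \<mu>"
    and "\<And>n. n \<ge> 1 \<Longrightarrow> rotation_invariant (\<mu> n)"
  shows "(\<exists>!\<nu>. is_projective_limit \<mu> \<nu>) \<and>
    (\<forall>\<nu>. is_projective_limit \<mu> \<nu> \<longrightarrow> random_graph UNIV \<nu> \<and> rotation_invariant \<nu>)"
proof -
  \<comment> \<open>Levels count from 0 and volumes from 1, hence the shift.\<close>
  define L :: "nat \<Rightarrow> (real^'n) set" where "L n = vol_ball (Suc n)" for n
  interpret graph_exhaustion L
    unfolding L_def by (rule graph_exhaustion_vol_ball)
  interpret projective_graphs L "\<lambda>n. \<mu> (Suc n)"
  proof
    show "random_graph (L n) (\<mu> (Suc n))" for n
      using assms(2) by (simp add: projective_system_def L_def)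
    show "\<mu> (Suc n) = distr (\<mu> (Suc m)) (sym_counting_space (L n)) (restrict_graph (L n))" if "n \<le> m" for n m
      using assms(2) that by (simp add: projective_system_def L_def)
  qed
  have limit_iff: "is_projective_limit \<mu> \<nu> \<longleftrightarrow> random_graph UNIV \<nu> \<and>
      (\<forall>n. distr \<nu> (sym_counting_space (L n)) (restrict_graph (L n)) = \<mu> (Suc n))" for \<nu>
    unfolding is_projective_limit_def all_ge_1_iff_all_Suc L_def ..
  have limitD: "random_graph UNIV \<nu>"
      "distr \<nu> (sym_counting_space (L n)) (restrict_graph (L n)) = \<mu> (Suc n)"
    if "is_projective_limit \<mu> \<nu>" for \<nu> n
    using limit_iff[THEN iffD1, OF that] by blast+
  have unique: "\<nu> = \<nu>'" if \<nu>: "is_projective_limit \<mu> \<nu>" "is_projective_limit \<mu> \<nu>'" for \<nu> \<nu>'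
  proof (rule random_graph_UNIV_eqI)
    show "random_graph UNIV \<nu>" "random_graph UNIV \<nu>'"
      by (fact limitD(1)[OF \<nu>(1)], fact limitD(1)[OF \<nu>(2)])
    show "distr \<nu> (sym_counting_space (L n)) (restrict_graph (L n)) =
        distr \<nu>' (sym_counting_space (L n)) (restrict_graph (L n))" for n
      by (simp only: limitD(2)[OF \<nu>(1)] limitD(2)[OF \<nu>(2)])
  qed
  have "rotation_invariant \<nu>" if \<nu>: "is_projective_limit \<mu> \<nu>" for \<nu>
  proof -
    note rg = limitD(1)[OF \<nu>] and lim = limitD(2)[OF \<nu>]
    have sets: "sets \<nu> = sets (sym_counting_space UNIV)" using rg by (simp add: random_graph_def)
    have "distr \<nu> (sym_counting_space UNIV) (act \<phi>) = \<nu>" if \<phi>: "is_rotation \<phi>" for \<phi> :: "real^'n \<Rightarrow> real^'n"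
    proof (rule unique[OF _ \<nu>])
      have \<phi>_UNIV: "\<phi> ` UNIV = UNIV" using is_rotation_props(2)[OF \<phi>] by (rule bij_is_surj)
      \<comment> \<open>Stated for all rotations, since \<open>rotation_invariant_iff_distr\<close>
        requires the window to be invariant under each of them.\<close>
      have \<phi>_L': "\<psi> ` L n = L n" if "is_rotation \<psi>" for \<psi> n
        unfolding L_def using that by (rule rotation_image_vol_ball)
      note \<phi>_L = \<phi>_L'[OF \<phi>]
      have a: "act \<phi> \<in> measurable \<nu> (sym_counting_space UNIV)"
        using measurable_act_rotation[OF \<phi> open_UNIV \<phi>_UNIV]
        by (simp only: measurable_cong_sets[OF sets refl])
      have r: "restrict_graph (L n) \<in> measurable \<nu> (sym_counting_space (L n))" for n
        using measurable_restrict_graph[OF open_L subset_UNIV]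
        by (simp only: measurable_cong_sets[OF sets refl])
      have "distr (distr \<nu> (sym_counting_space UNIV) (act \<phi>)) (sym_counting_space (L n)) (restrict_graph (L n)) =
          \<mu> (Suc n)" for n
      proof -
        have "distr (distr \<nu> (sym_counting_space UNIV) (act \<phi>)) (sym_counting_space (L n)) (restrict_graph (L n)) =
            distr \<nu> (sym_counting_space (L n)) (restrict_graph (L n) \<circ> act \<phi>)"
          by (rule distr_distr[OF measurable_restrict_graph[OF open_L subset_UNIV] a])
        also have "\<dots> = distr \<nu> (sym_counting_space (L n)) (act \<phi> \<circ> restrict_graph (L n))"
        proof (rule distr_cong)
          fix \<xi> assume "\<xi> \<in> space \<nu>"
          then have "\<xi> \<in> sym_counting_measures UNIV"
            using sets_eq_imp_space_eq[OF sets] by simp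
          then show "(restrict_graph (L n) \<circ> act \<phi>) \<xi> = (act \<phi> \<circ> restrict_graph (L n)) \<xi>"
            using restrict_graph_act_rotation[OF \<phi> open_L \<phi>_L open_UNIV \<phi>_UNIV subset_UNIV] by simp
        qed simp_all
        also have "\<dots> = distr (distr \<nu> (sym_counting_space (L n)) (restrict_graph (L n))) (sym_counting_space (L n)) (act \<phi>)"
          by (rule distr_distr[OF measurable_act_rotation[OF \<phi> open_L \<phi>_L] r, symmetric])
        also have "\<dots> = distr (\<mu> (Suc n)) (sym_counting_space (L n)) (act \<phi>)"
          by (simp only: lim)
        \<comment> \<open>Invariance of the given random graphs enters here, after the rotation has
          been moved past the restriction.\<close>
        also have "\<dots> = \<mu> (Suc n)"
          using rotation_invariant_iff_distr[OF random_graph_\<mu> open_L \<phi>_L', of n] assms(3)[of "Suc n"] \<phi> by simp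
        finally show ?thesis .
      qed
      moreover have "random_graph UNIV (distr \<nu> (sym_counting_space UNIV) (act \<phi>))"
        using prob_space.prob_space_distr[OF _ a] rg by (simp add: random_graph_def)
      ultimately show "is_projective_limit \<mu> (distr \<nu> (sym_counting_space UNIV) (act \<phi>))"
        unfolding limit_iff by blast
    qed
    then show ?thesis
      using rotation_invariant_iff_distr[OF rg open_UNIV] is_rotation_props(2) bij_is_surj by blast
  qed
  moreover have "\<exists>\<nu>. is_projective_limit \<mu> \<nu>"
    using ex_projective_limit unfolding limit_iff .
  ultimately show ?thesis
    using unique limitD(1) by (intro conjI ex_ex1I allI impI) simp_all
qed

end
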